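(* For any $\alpha>-1$, the asymptotic Markov constant $c(\alpha)=\lim_{n\to\infty} n^{-1}c_n(\alpha)$ satisfies the inequalities $$\frac{2}{(\alpha+1)(\alpha+5)}<[c(\alpha)]^2<\begin{cases}\dfrac{1}{(\alpha+1)\sqrt[3]{(\alpha+3)(\alpha+5)}}, & -1<\alpha\le\alpha^*,\\[2mm] \dfrac{4}{\alpha^2+10\alpha+8}, & \alpha>\alpha^*,\end{cases}$$ where $\alpha^*\approx 43.4$.
   Context: For $\alpha>-1$ let $w_\alpha(t)=t^\alpha e^{-t}$ be the Laguerre weight function on $(0,\infty)$, and let $\|f\|_{w_\alpha}=\left(\int_0^\infty |f(x)|^2 w_\alpha(x)\,dx\right)^{1/2}$ be the associated $L_2$-norm. $\mathcal{P}_n$ is the set of algebraic polynomials of degree at most $n$. The best Markov constant is $c_n(\alpha)=\sup_{p\in\mathcal{P}_n,\,p\ne 0}\|p'\|_{w_\alpha}/\|p\|_{w_\alpha}$. It is known (Dörfler) that the limit $c(\alpha)=\lim_{n\to\infty}c_n(\alpha)/n$ equals $1/j_{(\alpha-1)/2,1}$, where $j_{\nu,1}$ is the first positive zero of the Bessel function $J_\nu$. *)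

theory Defs
  imports "HOL-Analysis.Analysis" "HOL-Computational_Algebra.Polynomial"
begin

definition laguerre_weight :: "real \<Rightarrow> real \<Rightarrow> real" where
  "laguerre_weight \<alpha> t = t powr \<alpha> * exp (- t)"

definition laguerre_norm :: "real \<Rightarrow> (real \<Rightarrow> real) \<Rightarrow> real" where
  "laguerre_norm \<alpha> f = sqrt (LINT x:{0<..}|lborel. \<bar>f x\<bar>\<^sup>2 * laguerre_weight \<alpha> x)"

text \<open>The polynomials have real coefficients. For \<open>\<alpha> > -1\<close> every integral occurring here is finite,
  the quotients have positive denominators, and for fixed \<open>n\<close> they form a nonempty set bounded above,
  so the real supremum is the genuine one.\<close>

definition markov_const :: "nat \<Rightarrow> real \<Rightarrow> real" where
  "markov_const n \<alpha> =
     Sup {laguerre_norm \<alpha> (poly (pderiv p)) / laguerre_norm \<alpha> (poly p) | p :: real poly.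
            degree p \<le> n \<and> p \<noteq> 0}"

definition asymp_markov_const :: "real \<Rightarrow> real" where
  "asymp_markov_const \<alpha> = lim (\<lambda>n. markov_const n \<alpha> / real n)"

text \<open>The threshold \<open>\<alpha>\<^sup>*\<close>, approximately \<open>43.4\<close>, is the unique point of \<open>(-1, \<infinity>)\<close> at which the two
  upper bounds coincide (unique existence is the lemma \<open>alpha_star_ex1\<close>).\<close>

definition alpha_star :: real where
  "alpha_star = (THE a. a > -1 \<and>
     1 / ((a + 1) * root 3 ((a + 3) * (a + 5))) = 4 / (a\<^sup>2 + 10 * a + 8))"

lemma bounds_agree_iff:
  fixes a :: real
  assumes a: "a > -1"
  defines "y \<equiv> 1 / (a + 1)"
  shows "1 / ((a + 1) * root 3 ((a + 3) * (a + 5))) = 4 / (a\<^sup>2 + 10 * a + 8) \<longleftrightarrow>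
         40*y + 195*y^2 + 48*y^3 + 189*y^4 - 24*y^5 + y^6 = 1"
proof -
  define x where "x = a + 1"
  have x: "x > 0" and ax: "a = x - 1" using a by (auto simp: x_def)
  define u where "u = a\<^sup>2 + 10 * a + 8"
  define r where "r = root 3 ((a + 3) * (a + 5))"
  have r: "r > 0" using a by (simp add: r_def)
  have r3: "r ^ 3 = (x + 2) * (x + 4)" using a by (simp add: r_def ax add.commute)
  have "1 / ((a + 1) * r) = 4 / u \<longleftrightarrow> u = 4 * (x * r)"
    using x r unfolding ax by (cases "u = 0") (auto simp: field_simps)
  also have "\<dots> \<longleftrightarrow> u ^ 3 = (4 * (x * r)) ^ 3"
    by (metis odd_real_root_power_cancel odd_numeral)
  also have "(4 * (x * r)) ^ 3 = 64 * x ^ 3 * ((x + 2) * (x + 4))"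
    by (simp add: power_mult_distrib r3)
  also have "u ^ 3 = 64 * x ^ 3 * ((x + 2) * (x + 4)) \<longleftrightarrow>
      40*x^5 + 195*x^4 + 48*x^3 + 189*x^2 - 24*x + 1 = x^6"
    unfolding u_def ax by (auto simp: algebra_simps eval_nat_numeral)
  also have "\<dots> \<longleftrightarrow> 40*y + 195*y^2 + 48*y^3 + 189*y^4 - 24*y^5 + y^6 = 1"
  proof -
    have "(40*y + 195*y^2 + 48*y^3 + 189*y^4 - 24*y^5 + y^6) * x^6
        = 40*x^5 + 195*x^4 + 48*x^3 + 189*x^2 - 24*x + 1"
      using x unfolding y_def ax by (simp add: field_simps eval_nat_numeral)
    moreover have "x ^ 6 \<noteq> 0" using x by simp
    ultimately show ?thesis by (metis mult_1 mult_right_cancel)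
  qed
  finally show ?thesis unfolding u_def r_def .
qed

lemma alpha_star_ex1:
  "\<exists>!a::real. a > -1 \<and> 1 / ((a + 1) * root 3 ((a + 3) * (a + 5))) = 4 / (a\<^sup>2 + 10 * a + 8)"
proof -
  define h :: "real \<Rightarrow> real" where
    "h = (\<lambda>y. 40*y + 195*y^2 + 48*y^3 + 189*y^4 - 24*y^5 + y^6)"
  have mono: "h y < h z" if "0 < y" "y < z" for y z
  proof (rule DERIV_pos_imp_increasing[OF that(2)])
    fix t assume "y \<le> t"
    hence t: "t > 0" using that by simp
    have "(h has_real_derivative (40 + 390*t + 144*t^2 + 756*t^3 - 120*t^4 + 6*t^5)) (at t)"
      unfolding h_def by (auto intro!: derivative_eq_intros)
    moreover have "756*t^3 - 120*t^4 + 6*t^5 = 6*t^3 * ((t - 10)^2 + 26)"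
      by (simp add: algebra_simps eval_nat_numeral)
    moreover have "6*t^3 * ((t - 10)^2 + 26) \<ge> 0" using t by simp
    moreover have "390*t + 144*t^2 > 0" using t by (simp add: add_pos_pos)
    ultimately show "\<exists>d. (h has_real_derivative d) (at t) \<and> 0 < d"
      by (intro exI conjI) (assumption, linarith)
  qed
  have "\<exists>y. 0 \<le> y \<and> y \<le> 1 \<and> h y = 1"
    by (rule IVT') (auto simp: h_def intro!: continuous_intros)
  then obtain y where y: "0 \<le> y" "h y = 1" by blast
  hence "y > 0" by (cases "y = 0") (auto simp: h_def)
  show ?thesis
  proof (rule ex1I[of _ "1 / y - 1"], goal_cases)
    case 1
    show ?case using bounds_agree_iff[of "1 / y - 1"] \<open>y > 0\<close> y(2) by (simp add: h_def)
  next
    case (2 a)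
    have "h (1 / (a + 1)) = 1" using bounds_agree_iff[of a] 2 by (simp add: h_def)
    hence "1 / (a + 1) = y"
      using mono[of y "1 / (a + 1)"] mono[of "1 / (a + 1)" y] y(2) \<open>y > 0\<close> 2
      by (cases "1 / (a + 1)" y rule: linorder_cases) auto
    thus ?case using \<open>y > 0\<close> 2 by (auto simp: field_simps)
  qed
qed

end

theory Submission
  imports Defs
begin

text \<open>
  For \<open>p = (\<Sum>k<n. (v k - v (k + 1)) L\<^sub>k\<^sub>+\<^sub>1)\<close> with Laguerre polynomials \<open>L\<^sub>k\<close> and \<open>v n = 0\<close> one has
  \<open>p' = - (\<Sum>k<n. v k L\<^sub>k)\<close>. Up to an additive constant every polynomial of degree at most \<open>n\<close> has
  this form, so by orthogonality \<open>1 / c\<^sub>n\<^sup>2\<close> is the minimum of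
  \<open>(\<Sum>k<n. M\<^sub>k\<^sub>+\<^sub>1 (v k - v (k + 1))\<^sup>2) / (\<Sum>k<n. M\<^sub>k (v k)\<^sup>2)\<close> over \<open>v\<close> with \<open>v n = 0\<close>, where
  \<open>M\<^sub>k\<close> is proportional to \<open>\<parallel>L\<^sub>k\<parallel>\<^sup>2\<close>. This is a discrete Sturm-Liouville problem. Its difference
  equation with eigenvalue parameter \<open>l\<close> and initial value 1 has a unique solution
  \<open>solution \<alpha> l\<close>, and \<open>1 / c\<^sub>n\<^sup>2\<close> is the first zero of \<open>l \<mapsto> solution \<alpha> l n\<close>: a positive solution
  gives a Picone inequality (\<open>discrete_picone\<close>), and a solution vanishing at \<open>n\<close> is itself an
  eigenvector (\<open>solution_rayleigh\<close>).

  The weights \<open>M\<^sub>k\<close> grow like \<open>k\<^sup>\<alpha>\<close>, so after the scaling \<open>l = t / n\<^sup>2\<close> the solutions approach those of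
  \<open>(x\<^sup>\<alpha> u')' = - t x\<^sup>\<alpha> u\<close> on \<open>(0, 1)\<close>. Precisely, \<open>solution \<alpha> (t / n\<^sup>2) n\<close> converges, uniformly for
  bounded \<open>t \<ge> 0\<close>, to the entire function
  \<open>F(t) = \<Gamma>(\<nu> + 1) (\<surd>t / 2)\<^sup>-\<^sup>\<nu> J\<^sub>\<nu>(\<surd>t)\<close> with \<open>\<nu> = (\<alpha> - 1) / 2\<close> (\<open>scaled_solution_uniform_limit\<close>). If \<open>z\<close> is
  the first positive zero of \<open>F\<close>, then \<open>F'(z) < 0\<close>, so first zeros converge as well and
  \<open>c\<^sub>n / n\<close> tends to \<open>1 / \<surd>z\<close> (\<open>markov_const_limit\<close>).

  It remains to locate \<open>z\<close>, which is done by comparing \<open>F\<close> with explicit functions. With \<open>a = \<alpha> + 1\<close>,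
  \<open>F\<close> satisfies \<open>t F'' + (a/2) F' + F/4 = 0\<close>, and the Wronskian \<open>t\<^bsup>a/2\<^esup> (F' G - F G')\<close> is strictly
  monotone as long as \<open>F > 0\<close> and \<open>t G'' + (a/2) G' + G/4\<close> has a fixed sign
  (\<open>bessel_wronskian_pos\<close>). A strict supersolution \<open>G\<close> that is nonnegative on \<open>(0, M]\<close> therefore
  keeps \<open>F\<close> positive on \<open>[0, M]\<close>, and a strict subsolution vanishing at \<open>M\<close> together with its derivative forces a zero of \<open>F\<close> before \<open>M\<close>.

  Two of the functions \<open>G\<close> come from the expansion \<open>- F'/F = \<sigma>\<^sub>1 + \<sigma>\<^sub>2 t + \<sigma>\<^sub>3 t\<^sup>2 + \<dots>\<close>, whose radius of
  convergence is \<open>z\<close> and whose coefficients are the Rayleigh sums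
  \<open>\<sigma>\<^sub>1 = 1 / (2 a)\<close>, \<open>\<sigma>\<^sub>2 = 1 / (2 a\<^sup>2 (a + 2))\<close>, \<open>\<sigma>\<^sub>3 = 1 / (a\<^sup>3 (a + 2) (a + 4))\<close>.
  Replacing \<open>\<sigma>\<^sub>k\<close> by a geometric sequence from some index on, with ratio \<open>q = \<sigma>\<^sub>3 / \<sigma>\<^sub>2\<close> for the lower
  bound and \<open>q = root 3 \<sigma>\<^sub>3\<close> for the first upper bound, gives a logarithmic derivative with a pole
  at \<open>1 / q\<close>, and hence a \<open>G\<close> vanishing there. For the second upper bound, which is the stronger one
  for large \<open>\<alpha>\<close>, a linear factor times an exponential suffices. The resulting
  estimates \<open>z > a * root 3 ((a + 2) (a + 4))\<close> and \<open>z > a (a + 8) / 4\<close> hold for every \<open>\<alpha> > -1\<close>.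
\<close>

section \<open>Laguerre polynomials\<close>

definition weighted_integral :: "real \<Rightarrow> real poly \<Rightarrow> real" where
  "weighted_integral \<alpha> p = (LINT x:{0<..}|lborel. poly p x * laguerre_weight \<alpha> x)"

text \<open>
  The recursion is the raising relation \<open>(k + 1) L\<^sub>k\<^sub>+\<^sub>1 = x L\<^sub>k' + (k + 1 + \<alpha> - x) L\<^sub>k\<close>; from it
  the differential equation and the derivative formulas follow by one joint induction, without
  explicit coefficients.
\<close>

fun laguerre :: "real \<Rightarrow> nat \<Rightarrow> real poly" where
  "laguerre \<alpha> 0 = 1"
| "laguerre \<alpha> (Suc k) = smult (1 / real (Suc k))
     ([:0, 1:] * pderiv (laguerre \<alpha> k) + [:real k + 1 + \<alpha>, -1:] * laguerre \<alpha> k)"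

text \<open>
  The squared norm of \<open>L\<^sub>k\<close> divided by \<open>\<Gamma>(\<alpha> + 1)\<close>.
\<close>

definition laguerre_mass :: "real \<Rightarrow> nat \<Rightarrow> real" where
  "laguerre_mass \<alpha> k = pochhammer (\<alpha> + 1) k / fact k"

text \<open>
  These are Euler integrals for the Gamma function; the work lies in passing from the
  Henstock-Kurzweil integral to the Lebesgue integral.
\<close>

lemma monomial_integral:
  assumes "\<alpha> > -1"
  shows "set_integrable lborel {0<..} (\<lambda>x. poly (monom c i) x * laguerre_weight \<alpha> x)"
    and "weighted_integral \<alpha> (monom c i) = c * Gamma (\<alpha> + 1 + real i)"
proof -
  define z where "z = \<alpha> + 1 + real i"
  have z: "z > 0" using assms by (simp add: z_def)
  have eq: "x ^ i * laguerre_weight \<alpha> x = x powr (z - 1) / exp x" if "x \<in> {0<..}" for x :: real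
    using that by (simp add: z_def laguerre_weight_def powr_add powr_realpow exp_minus field_simps)
  have nn: "(\<lambda>x::real. x powr (z - 1) / exp x) absolutely_integrable_on {0<..}"
    and int: "((\<lambda>x::real. x powr (z - 1) / exp x) has_integral Gamma z) {0<..}"
  proof -
    have "((\<lambda>x::real. x powr (z - 1) / exp x) has_integral Gamma z) {0..}"
      by (rule Gamma_integral_real[OF z])
    hence "((\<lambda>t. if t \<in> {0<..} then t powr (z - 1) / exp t else 0) has_integral Gamma z) {0..}"
      by (rule has_integral_spike [of "{0}", rotated 2]) auto
    thus int: "((\<lambda>x::real. x powr (z - 1) / exp x) has_integral Gamma z) {0<..}"
      by (subst (asm) has_integral_restrict) auto
    show "(\<lambda>x::real. x powr (z - 1) / exp x) absolutely_integrable_on {0<..}"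
      using int by (intro nonnegative_absolutely_integrable_1) (auto simp: has_integral_iff)
  qed
  have "(\<lambda>x::real. x ^ i * laguerre_weight \<alpha> x) absolutely_integrable_on {0<..}"
    using nn by (rule set_integrable_cong[THEN iffD2, rotated -1]) (auto simp: eq)
  hence si: "set_integrable lborel {0<..} (\<lambda>x::real. x ^ i * laguerre_weight \<alpha> x)"
    unfolding set_integrable_def
    by (subst (asm) integrable_completion) (auto simp: laguerre_weight_def)
  from set_borel_integral_eq_integral[OF si]
  have "(LINT x:{0<..}|lborel. x ^ i * laguerre_weight \<alpha> x)
      = integral {0<..} (\<lambda>x. x ^ i * laguerre_weight \<alpha> x)" by simp
  also have "\<dots> = integral {0<..} (\<lambda>x. x powr (z - 1) / exp x)"
    by (rule integral_cong) (rule eq)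
  also have "\<dots> = Gamma z" using int by (simp add: has_integral_iff)
  finally have I: "(LINT x:{0<..}|lborel. x ^ i * laguerre_weight \<alpha> x) = Gamma z" .
  show "set_integrable lborel {0<..} (\<lambda>x. poly (monom c i) x * laguerre_weight \<alpha> x)"
    using set_integrable_mult_right[of c, OF si] by (simp add: poly_monom mult.assoc)
  show "weighted_integral \<alpha> (monom c i) = c * Gamma (\<alpha> + 1 + real i)"
    using I by (simp add: weighted_integral_def poly_monom mult.assoc z_def)
qed

lemma poly_induct_monom [case_names add monom]:
  fixes p :: "'a :: comm_monoid_add poly"
  assumes "\<And>p q. P p \<Longrightarrow> P q \<Longrightarrow> P (p + q)" "\<And>c i. P (monom c i)"
  shows "P p"
proof -
  have "P (\<Sum>i\<in>A. monom (coeff p i) i)" if "finite A" for A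
    using that
  proof induction
    case empty
    show ?case using assms(2)[of 0] by simp
  qed (auto intro: assms)
  thus ?thesis using poly_as_sum_of_monoms[of p] by (metis finite_atMost)
qed

lemma weighted_integrable:
  assumes "\<alpha> > -1"
  shows "set_integrable lborel {0<..} (\<lambda>x. poly p x * laguerre_weight \<alpha> x)"
proof (induction p rule: poly_induct_monom)
  case (add p q)
  thus ?case by (simp add: distrib_right set_integral_add)
qed (rule monomial_integral[OF assms])

lemma weighted_integral_add:
  assumes "\<alpha> > -1"
  shows "weighted_integral \<alpha> (p + q) = weighted_integral \<alpha> p + weighted_integral \<alpha> q"
  using weighted_integrable[OF assms]
  by (simp add: weighted_integral_def distrib_right set_integral_add)

lemma weighted_integral_smult: "weighted_integral \<alpha> (smult c p) = c * weighted_integral \<alpha> p"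
  by (simp add: weighted_integral_def mult.assoc)

lemma weighted_integral_0 [simp]: "weighted_integral \<alpha> 0 = 0"
  by (simp add: weighted_integral_def)

lemma weighted_integral_minus: "weighted_integral \<alpha> (- p) = - weighted_integral \<alpha> p"
  using weighted_integral_smult[of \<alpha> "-1" p] by simp

lemma weighted_integral_diff:
  assumes "\<alpha> > -1"
  shows "weighted_integral \<alpha> (p - q) = weighted_integral \<alpha> p - weighted_integral \<alpha> q"
  using weighted_integral_add[OF assms, of p "- q"] by (simp add: weighted_integral_minus)

lemma weighted_integral_sum:
  assumes "\<alpha> > -1"
  shows "weighted_integral \<alpha> (\<Sum>i\<in>A. f i) = (\<Sum>i\<in>A. weighted_integral \<alpha> (f i))"
  by (induction A rule: infinite_finite_induct) (simp_all add: weighted_integral_add[OF assms])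

lemma laguerre_norm_poly: "laguerre_norm \<alpha> (poly p) = sqrt (weighted_integral \<alpha> (p * p))"
  by (simp add: laguerre_norm_def weighted_integral_def power2_eq_square)

text \<open>
  The integrand times the weight is the derivative of \<open>x\<^bsup>\<alpha> + 1\<^esup> e\<^bsup>-x\<^esup> p\<close>, whose boundary values
  vanish. On monomials this is the functional equation of the Gamma function, and the integral is
  linear in \<open>p\<close>.
\<close>

lemma integration_by_parts:
  assumes "\<alpha> > -1"
  shows "weighted_integral \<alpha> ([:\<alpha> + 1, -1:] * p + [:0, 1:] * pderiv p) = 0"
proof (induction p rule: poly_induct_monom)
  case (add p q)
  have eq: "[:\<alpha> + 1, -1:] * (p + q) + [:0, 1:] * pderiv (p + q) =
    ([:\<alpha> + 1, -1:] * p + [:0, 1:] * pderiv p) + ([:\<alpha> + 1, -1:] * q + [:0, 1:] * pderiv q)"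
    by (simp only: pderiv_add distrib_left distrib_right add_ac)
  have "weighted_integral \<alpha> ([:\<alpha> + 1, -1:] * (p + q) + [:0, 1:] * pderiv (p + q)) = 0 + 0"
    unfolding eq by (subst weighted_integral_add[OF assms]) (simp only: add)
  thus ?case by simp
next
  case (monom c i)
  have 1: "[:\<alpha> + 1, -1:] * monom c i + [:0, 1:] * pderiv (monom c i) =
     monom ((\<alpha> + 1 + i) * c) i - monom c (Suc i)"
    by (cases i) (simp_all add: poly_eq_poly_eq_iff[symmetric] fun_eq_iff poly_monom pderiv_monom algebra_simps)
  have "Gamma (\<alpha> + 1 + real i + 1) = (\<alpha> + 1 + i) * Gamma (\<alpha> + 1 + real i)"
    by (rule Gamma_plus1) (use assms in \<open>auto elim!: nonpos_Ints_cases\<close>)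
  thus ?case
    unfolding 1 weighted_integral_diff[OF assms] monomial_integral(2)[OF assms]
    by (simp add: algebra_simps)
qed

text \<open>
  The induction runs over the differential equation alone. Differentiating the raising relation
  and eliminating \<open>x L\<^sub>k''\<close> with the equation for \<open>k\<close> gives the formula for \<open>L\<^sub>k\<^sub>+\<^sub>1'\<close>, hence the
  lowering relation; differentiating that one gives the equation for \<open>k + 1\<close>.
\<close>

lemma laguerre_structure:
  "[:0, 1:] * pderiv (pderiv (laguerre \<alpha> k)) + [:\<alpha> + 1, -1:] * pderiv (laguerre \<alpha> k)
      = smult (- real k) (laguerre \<alpha> k)" (is "?ode k")
  "pderiv (laguerre \<alpha> (Suc k)) = pderiv (laguerre \<alpha> k) - laguerre \<alpha> k" (is "?der k")
  "[:0, 1:] * pderiv (laguerre \<alpha> (Suc k))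
      = smult (real (Suc k)) (laguerre \<alpha> (Suc k)) - smult (real (Suc k) + \<alpha>) (laguerre \<alpha> k)"
    (is "?low k")
proof -
  have der: "?der k" if "?ode k" for k
  proof (rule poly_ext)
    fix x
    let ?L = "laguerre \<alpha> k"
    from that have "poly ([:0, 1:] * pderiv (pderiv ?L) + [:\<alpha> + 1, -1:] * pderiv ?L) x
      = poly (smult (- real k) ?L) x" by simp
    hence *: "x * poly (pderiv (pderiv ?L)) x =
       - real k * poly ?L x - (\<alpha> + 1 - x) * poly (pderiv ?L) x" by (simp add: algebra_simps)
    have "smult (real (Suc k)) (laguerre \<alpha> (Suc k))
        = [:0, 1:] * pderiv ?L + [:real k + 1 + \<alpha>, -1:] * ?L"
      by simp
    hence "poly (pderiv (smult (real (Suc k)) (laguerre \<alpha> (Suc k)))) x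
        = poly (pderiv ([:0, 1:] * pderiv ?L + [:real k + 1 + \<alpha>, -1:] * ?L)) x"
      by (simp only:)
    hence "real (Suc k) * poly (pderiv (laguerre \<alpha> (Suc k))) x =
       x * poly (pderiv (pderiv ?L)) x + poly (pderiv ?L) x
       + (real k + 1 + \<alpha> - x) * poly (pderiv ?L) x - poly ?L x"
      by (simp add: pderiv_smult pderiv_add pderiv_mult pderiv_pCons pderiv_minus algebra_simps
               del: laguerre.simps)
    also have "\<dots> = real (Suc k) * (poly (pderiv ?L) x - poly ?L x)"
      unfolding * by (simp add: algebra_simps)
    finally show "poly (pderiv (laguerre \<alpha> (Suc k))) x = poly (pderiv ?L - ?L) x"
      by (subst (asm) mult_cancel_left) simp
  qed
  have low: "?low k" if "?der k" for k
    unfolding that by (rule poly_ext) (simp add: field_simps)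
  have ode: "?ode k"
  proof (induction k)
    case 0
    show ?case by (simp add: pderiv_1)
  next
    case (Suc k)
    let ?L = "laguerre \<alpha> k" and ?M = "laguerre \<alpha> (Suc k)"
    have d: "?der k" by (rule der[OF Suc.IH])
    have l: "?low k" by (rule low[OF d])
    show ?case
    proof (rule poly_ext)
      fix x
      have "poly (pderiv ([:0, 1:] * pderiv ?M)) x =
        poly (pderiv (smult (real (Suc k)) ?M - smult (real (Suc k) + \<alpha>) ?L)) x"
        by (simp only: l)
      hence 1: "poly (pderiv ?M) x + x * poly (pderiv (pderiv ?M)) x =
         real (Suc k) * poly (pderiv ?M) x - (real (Suc k) + \<alpha>) * poly (pderiv ?L) x"
        by (simp add: pderiv_smult pderiv_diff pderiv_mult pderiv_pCons del: laguerre.simps)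
      have 2: "poly (pderiv ?L) x = poly (pderiv ?M) x + poly ?L x"
        unfolding d by simp
      have 3: "x * poly (pderiv ?M) x =
         real (Suc k) * poly ?M x - (real (Suc k) + \<alpha>) * poly ?L x"
        using arg_cong[OF l, of "\<lambda>p. poly p x"] by (simp del: laguerre.simps)
      have "x * poly (pderiv (pderiv ?M)) x + (\<alpha> + 1 - x) * poly (pderiv ?M) x
         = - real (Suc k) * poly ?M x"
        using 1 3 unfolding 2 by (simp add: algebra_simps del: laguerre.simps)
      thus "poly ([:0, 1:] * pderiv (pderiv ?M) + [:\<alpha> + 1, -1:] * pderiv ?M) x
         = poly (smult (- real (Suc k)) ?M) x"
        by (simp add: algebra_simps del: laguerre.simps)
    qed
  qed
  show "?ode k" "?der k" "?low k" using ode der low by blast+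
qed

text \<open>
  The Laguerre operator is symmetric: this is integration by parts applied to \<open>L\<^sub>k' q\<close>. It yields
  orthogonality, because \<open>L\<^sub>j\<close> and \<open>L\<^sub>k\<close> may exchange roles, and also the norms.
\<close>

lemma laguerre_energy:
  assumes "\<alpha> > -1"
  shows "weighted_integral \<alpha> ([:0, 1:] * pderiv (laguerre \<alpha> k) * pderiv q)
       = real k * weighted_integral \<alpha> (laguerre \<alpha> k * q)"
proof -
  let ?L = "laguerre \<alpha> k"
  have "[:\<alpha> + 1, -1:] * (pderiv ?L * q) + [:0, 1:] * pderiv (pderiv ?L * q)
     = ([:0, 1:] * pderiv (pderiv ?L) + [:\<alpha> + 1, -1:] * pderiv ?L) * q
       + [:0, 1:] * pderiv ?L * pderiv q"
    by (simp only: pderiv_mult distrib_left distrib_right) (simp only: ac_simps)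
  also have "\<dots> = smult (- real k) (?L * q) + [:0, 1:] * pderiv ?L * pderiv q"
    unfolding laguerre_structure(1) by simp
  finally show ?thesis
    using integration_by_parts[OF assms, of "pderiv ?L * q"]
    by (simp only: weighted_integral_add[OF assms] weighted_integral_smult)
qed

lemma laguerre_orthogonal:
  assumes "\<alpha> > -1" "j \<noteq> k"
  shows "weighted_integral \<alpha> (laguerre \<alpha> j * laguerre \<alpha> k) = 0"
proof -
  have "real j * weighted_integral \<alpha> (laguerre \<alpha> j * laguerre \<alpha> k)
      = real k * weighted_integral \<alpha> (laguerre \<alpha> j * laguerre \<alpha> k)"
    using laguerre_energy[OF assms(1), of j "laguerre \<alpha> k"]
      laguerre_energy[OF assms(1), of k "laguerre \<alpha> j"] by (simp only: ac_simps)
  thus ?thesis using assms(2) by simp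
qed

lemma laguerre_mass_0 [simp]: "laguerre_mass \<alpha> 0 = 1"
  by (simp add: laguerre_mass_def)

lemma laguerre_mass_Suc:
  "real (Suc k) * laguerre_mass \<alpha> (Suc k) = (real (Suc k) + \<alpha>) * laguerre_mass \<alpha> k"
  by (simp add: laguerre_mass_def pochhammer_rec' divide_simps)

lemma laguerre_mass_pos: "\<alpha> > -1 \<Longrightarrow> laguerre_mass \<alpha> k > 0"
  by (auto simp: laguerre_mass_def intro!: divide_pos_pos pochhammer_pos)

text \<open>
  Evaluating \<open>k \<parallel>L\<^sub>k\<parallel>\<^sup>2\<close> as the integral of \<open>x L\<^sub>k'\<^sup>2 w\<close>, with \<open>L\<^sub>k' = L\<^sub>k\<^sub>-\<^sub>1' - L\<^sub>k\<^sub>-\<^sub>1\<close> for one factor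
  and the lowering relation for the other, leaves only \<open>(k + \<alpha>) \<parallel>L\<^sub>k\<^sub>-\<^sub>1\<parallel>\<^sup>2\<close> by orthogonality.
\<close>

lemma laguerre_norm_square:
  assumes "\<alpha> > -1"
  shows "weighted_integral \<alpha> (laguerre \<alpha> k * laguerre \<alpha> k) = Gamma (\<alpha> + 1) * laguerre_mass \<alpha> k"
proof (induction k)
  case 0
  have "weighted_integral \<alpha> (monom 1 0) = Gamma (\<alpha> + 1)"
    using monomial_integral(2)[OF assms, of 1 0] by simp
  thus ?case by simp
next
  case (Suc k)
  let ?E = "weighted_integral \<alpha>" and ?L = "laguerre \<alpha> k" and ?M = "laguerre \<alpha> (Suc k)"
  have "real (Suc k) * ?E (?M * ?M) = ?E ([:0, 1:] * pderiv ?M * (pderiv ?L - ?L))"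
    unfolding laguerre_energy[OF assms, of "Suc k" ?M, symmetric]
    by (simp only: laguerre_structure(2))
  also have "[:0, 1:] * pderiv ?M * (pderiv ?L - ?L)
      = [:0, 1:] * pderiv ?M * pderiv ?L - ([:0, 1:] * pderiv ?M) * ?L"
    by (simp only: right_diff_distrib)
  also have "?E \<dots> = real (Suc k) * ?E (?M * ?L) - ?E (([:0, 1:] * pderiv ?M) * ?L)"
    by (simp only: weighted_integral_diff[OF assms] laguerre_energy[OF assms])
  also have "([:0, 1:] * pderiv ?M) * ?L
      = smult (real (Suc k)) (?M * ?L) - smult (real (Suc k) + \<alpha>) (?L * ?L)"
    unfolding laguerre_structure(3) by (simp only: left_diff_distrib mult_smult_left)
  also have "?E (?M * ?L) = 0" by (rule laguerre_orthogonal[OF assms]) simp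
  finally have "real (Suc k) * ?E (?M * ?M) = (real (Suc k) + \<alpha>) * ?E (?L * ?L)"
    using laguerre_orthogonal[OF assms, of "Suc k" k]
    by (simp only: weighted_integral_diff[OF assms] weighted_integral_smult)
  also have "\<dots> = Gamma (\<alpha> + 1) * ((real (Suc k) + \<alpha>) * laguerre_mass \<alpha> k)"
    unfolding Suc.IH by (simp only: ac_simps)
  also have "\<dots> = real (Suc k) * (Gamma (\<alpha> + 1) * laguerre_mass \<alpha> (Suc k))"
    unfolding laguerre_mass_Suc[symmetric] by (simp only: ac_simps)
  finally show ?case by (subst (asm) mult_cancel_left) simp
qed

lemma laguerre_degree: "degree (laguerre \<alpha> k) \<le> k \<and> coeff (laguerre \<alpha> k) k \<noteq> 0"
proof (induction k)
  case (Suc k)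
  let ?L = "laguerre \<alpha> k"
  have z: "coeff ?L i = 0" if "i > k" for i
    using Suc that by (intro coeff_eq_0) simp
  have c: "coeff (laguerre \<alpha> (Suc k)) (Suc i) = (1 / real (Suc k)) *
     (real (Suc i) * coeff ?L (Suc i) + (real k + 1 + \<alpha>) * coeff ?L (Suc i) - coeff ?L i)" for i
    by (simp add: coeff_pderiv)
  show ?case
  proof
    show "degree (laguerre \<alpha> (Suc k)) \<le> Suc k"
    proof (rule degree_le, intro allI impI)
      fix i assume "Suc k < i"
      then obtain j where "i = Suc j" "j > k" by (cases i) auto
      thus "coeff (laguerre \<alpha> (Suc k)) i = 0" using z[of j] z[of "Suc j"] by (simp only: c) simp
    qed
    show "coeff (laguerre \<alpha> (Suc k)) (Suc k) \<noteq> 0"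
      using Suc z[of "Suc k"] by (simp only: c) simp
  qed
qed simp

lemma laguerre_expansion:
  assumes "degree p \<le> n"
  shows "\<exists>c. p = (\<Sum>k\<le>n. smult (c k) (laguerre \<alpha> k))"
  using assms
proof (induction n arbitrary: p)
  case 0
  then obtain a where "p = [:a:]" by (metis degree_eq_zeroE le_zero_eq)
  thus ?case by (intro exI[of _ "\<lambda>_. a"]) simp
next
  case (Suc n)
  let ?L = "laguerre \<alpha> (Suc n)"
  define d where "d = coeff p (Suc n) / coeff ?L (Suc n)"
  have "degree (p - smult d ?L) \<le> n"
  proof (rule degree_le, intro allI impI)
    fix i assume "n < i"
    show "coeff (p - smult d ?L) i = 0"
    proof (cases "i = Suc n")
      case True
      thus ?thesis using laguerre_degree[of \<alpha> "Suc n"] by (simp add: d_def del: laguerre.simps)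
    next
      case False
      hence "i > Suc n" using \<open>n < i\<close> by simp
      hence "coeff p i = 0" "coeff ?L i = 0"
        using Suc.prems laguerre_degree[of \<alpha> "Suc n"] by (auto intro!: coeff_eq_0 simp del: laguerre.simps)
      thus ?thesis by (simp del: laguerre.simps)
    qed
  qed
  from Suc.IH[OF this] obtain c where c: "p - smult d ?L = (\<Sum>k\<le>n. smult (c k) (laguerre \<alpha> k))"
    by blast
  have "p = (\<Sum>k\<le>n. smult (c k) (laguerre \<alpha> k)) + smult d ?L"
    unfolding c[symmetric] by simp
  also have "\<dots> = (\<Sum>k\<le>Suc n. smult ((c(Suc n := d)) k) (laguerre \<alpha> k))"
    by (simp del: laguerre.simps)
  finally show ?case by blast
qed

lemma weighted_integral_square_sum:
  assumes "\<alpha> > -1" "inj_on f A" "finite A"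
  shows "weighted_integral \<alpha> ((\<Sum>k\<in>A. smult (c k) (laguerre \<alpha> (f k))) * (\<Sum>k\<in>A. smult (c k) (laguerre \<alpha> (f k))))
       = Gamma (\<alpha> + 1) * (\<Sum>k\<in>A. laguerre_mass \<alpha> (f k) * (c k)\<^sup>2)"
proof -
  have "weighted_integral \<alpha> ((\<Sum>k\<in>A. smult (c k) (laguerre \<alpha> (f k))) * (\<Sum>k\<in>A. smult (c k) (laguerre \<alpha> (f k))))
    = (\<Sum>j\<in>A. \<Sum>k\<in>A. c j * c k * weighted_integral \<alpha> (laguerre \<alpha> (f j) * laguerre \<alpha> (f k)))"
    by (simp add: sum_product weighted_integral_sum[OF assms(1)] weighted_integral_smult mult.commute)
  also have "\<dots> = (\<Sum>j\<in>A. \<Sum>k\<in>A. if k = j then Gamma (\<alpha> + 1) * (laguerre_mass \<alpha> (f j) * (c j)\<^sup>2) else 0)"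
  proof (intro sum.cong refl)
    fix j k assume jk: "j \<in> A" "k \<in> A"
    show "c j * c k * weighted_integral \<alpha> (laguerre \<alpha> (f j) * laguerre \<alpha> (f k)) =
      (if k = j then Gamma (\<alpha> + 1) * (laguerre_mass \<alpha> (f j) * (c j)\<^sup>2) else 0)"
    proof (cases "k = j")
      case True
      thus ?thesis by (simp add: laguerre_norm_square[OF assms(1)] power2_eq_square)
    next
      case False
      hence "f j \<noteq> f k" using jk assms(2) by (auto dest: inj_onD)
      thus ?thesis using False by (simp add: laguerre_orthogonal[OF assms(1)])
    qed
  qed
  also have "\<dots> = Gamma (\<alpha> + 1) * (\<Sum>k\<in>A. laguerre_mass \<alpha> (f k) * (c k)\<^sup>2)"
    using assms(3) by (simp add: sum_distrib_left)
  finally show ?thesis .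
qed

section \<open>The discrete eigenvalue problem\<close>

text \<open>
  Since \<open>L\<^sub>k\<^sub>+\<^sub>1' - L\<^sub>k' = - L\<^sub>k\<close>, summation by parts turns the derivative of \<open>q\<close> into a sum with
  coefficients \<open>- v k\<close>; this is why differences of \<open>v\<close> are the right parameters.
\<close>

lemma markov_quadratic_forms:
  fixes v :: "nat \<Rightarrow> real"
  assumes "\<alpha> > -1" "v n = 0"
  defines "q \<equiv> (\<Sum>k<n. smult (v k - v (Suc k)) (laguerre \<alpha> (Suc k)))"
  shows "degree q \<le> n"
    and "pderiv q = - (\<Sum>k<n. smult (v k) (laguerre \<alpha> k))"
    and "weighted_integral \<alpha> (pderiv q * pderiv q)
       = Gamma (\<alpha> + 1) * (\<Sum>k<n. laguerre_mass \<alpha> k * (v k)\<^sup>2)"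
    and "weighted_integral \<alpha> (q * q)
       = Gamma (\<alpha> + 1) * (\<Sum>k<n. laguerre_mass \<alpha> (Suc k) * (v k - v (Suc k))\<^sup>2)"
proof -
  show "degree q \<le> n"
    unfolding q_def
  proof (rule degree_sum_le)
    fix k assume "k \<in> {..<n}"
    thus "degree (smult (v k - v (Suc k)) (laguerre \<alpha> (Suc k))) \<le> n"
      using laguerre_degree[of \<alpha> "Suc k"] degree_smult_le[of "v k - v (Suc k)" "laguerre \<alpha> (Suc k)"]
      by (simp del: laguerre.simps)
  qed simp
  have "(\<Sum>k<m. smult (v k - v (Suc k)) (pderiv (laguerre \<alpha> (Suc k)))) =
      - (\<Sum>k<m. smult (v k) (laguerre \<alpha> k)) - smult (v m) (pderiv (laguerre \<alpha> m))" for m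
  proof (induction m)
    case 0
    show ?case by (simp add: pderiv_1)
  next
    case (Suc m)
    have "smult (v m - v (Suc m)) (pderiv (laguerre \<alpha> (Suc m))) - smult (v m) (pderiv (laguerre \<alpha> m))
        = - smult (v m) (laguerre \<alpha> m) - smult (v (Suc m)) (pderiv (laguerre \<alpha> (Suc m)))"
      unfolding laguerre_structure(2) by (simp add: smult_diff_left smult_diff_right)
    thus ?case
      by (simp add: Suc.IH algebra_simps del: laguerre.simps)
  qed
  from this[of n] show d: "pderiv q = - (\<Sum>k<n. smult (v k) (laguerre \<alpha> k))"
    using assms(2) by (simp add: q_def higher_pderiv_sum[of 1, simplified] pderiv_smult del: laguerre.simps)
  show "weighted_integral \<alpha> (pderiv q * pderiv q)
       = Gamma (\<alpha> + 1) * (\<Sum>k<n. laguerre_mass \<alpha> k * (v k)\<^sup>2)"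
    using weighted_integral_square_sum[OF assms(1), of "\<lambda>k. k" "{..<n}" v] by (simp add: d)
  show "weighted_integral \<alpha> (q * q)
       = Gamma (\<alpha> + 1) * (\<Sum>k<n. laguerre_mass \<alpha> (Suc k) * (v k - v (Suc k))\<^sup>2)"
    unfolding q_def
    using weighted_integral_square_sum[OF assms(1), of Suc "{..<n}" "\<lambda>k. v k - v (Suc k)"]
    by (simp del: laguerre.simps)
qed

text \<open>
  Here \<open>v j\<close> is the sum of the Laguerre coefficients with index above \<open>j\<close>. The constant term of the
  expansion contributes to the norm of \<open>p\<close> but not to \<open>p'\<close>, whence the inequality.
\<close>

lemma poly_tail_sums:
  assumes "\<alpha> > -1" "degree p \<le> n"
  obtains v :: "nat \<Rightarrow> real" where "v n = 0"
    "weighted_integral \<alpha> (pderiv p * pderiv p)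
       = Gamma (\<alpha> + 1) * (\<Sum>k<n. laguerre_mass \<alpha> k * (v k)\<^sup>2)"
    "weighted_integral \<alpha> (p * p)
       \<ge> Gamma (\<alpha> + 1) * (\<Sum>k<n. laguerre_mass \<alpha> (Suc k) * (v k - v (Suc k))\<^sup>2)"
proof -
  obtain c where p: "p = (\<Sum>k\<le>n. smult (c k) (laguerre \<alpha> k))"
    using laguerre_expansion[OF assms(2)] by blast
  define v where "v = (\<lambda>j. \<Sum>k\<in>{j<..n}. c k)"
  have vn: "v n = 0" by (simp add: v_def)
  have dv: "v k - v (Suc k) = c (Suc k)" if "k < n" for k
  proof -
    have "{k<..n} = insert (Suc k) {Suc k<..n}" using that by auto
    thus ?thesis by (simp add: v_def)
  qed
  define q where "q = (\<Sum>k<n. smult (v k - v (Suc k)) (laguerre \<alpha> (Suc k)))"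
  have q: "q = (\<Sum>k<n. smult (c (Suc k)) (laguerre \<alpha> (Suc k)))"
    unfolding q_def by (intro sum.cong refl) (simp add: dv del: laguerre.simps)
  have "p = smult (c 0) 1 + q"
    unfolding p q lessThan_Suc_atMost[symmetric]
    by (simp add: sum.lessThan_Suc_shift del: laguerre.simps(2) sum.lessThan_Suc)
  hence dp: "pderiv p = pderiv q"
    by (simp add: pderiv_add pderiv_smult pderiv_1)
  have "weighted_integral \<alpha> (p * p) = Gamma (\<alpha> + 1) * (\<Sum>k\<le>n. laguerre_mass \<alpha> k * (c k)\<^sup>2)"
    unfolding p using weighted_integral_square_sum[OF assms(1), of "\<lambda>k. k" "{..n}" c] by simp
  also have "(\<Sum>k\<le>n. laguerre_mass \<alpha> k * (c k)\<^sup>2)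
     = (c 0)\<^sup>2 + (\<Sum>k<n. laguerre_mass \<alpha> (Suc k) * (c (Suc k))\<^sup>2)"
    unfolding lessThan_Suc_atMost[symmetric] by (simp add: sum.lessThan_Suc_shift del: sum.lessThan_Suc)
  also have "Gamma (\<alpha> + 1) * \<dots> \<ge> Gamma (\<alpha> + 1) * (\<Sum>k<n. laguerre_mass \<alpha> (Suc k) * (c (Suc k))\<^sup>2)"
    using Gamma_real_pos[of "\<alpha> + 1"] assms(1) by (intro mult_left_mono) auto
  finally have "weighted_integral \<alpha> (p * p)
     \<ge> Gamma (\<alpha> + 1) * (\<Sum>k<n. laguerre_mass \<alpha> (Suc k) * (c (Suc k))\<^sup>2)" .
  moreover have "(\<Sum>k<n. laguerre_mass \<alpha> (Suc k) * (c (Suc k))\<^sup>2)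
      = (\<Sum>k<n. laguerre_mass \<alpha> (Suc k) * (v k - v (Suc k))\<^sup>2)"
    by (intro sum.cong refl) (simp add: dv)
  ultimately show ?thesis
    using that[of v] vn markov_quadratic_forms(3)[of \<alpha> v n, OF assms(1) vn] dp unfolding q_def by simp
qed

text \<open>
  The solution \<open>s\<close> of \<open>M\<^sub>k\<^sub>+\<^sub>1 (s\<^sub>k - s\<^sub>k\<^sub>+\<^sub>1) = l (\<Sum>j\<le>k. M\<^sub>j s\<^sub>j)\<close>, \<open>s\<^sub>0 = 1\<close>, is a polynomial in \<open>l\<close>.
  \<open>solution_coeff \<alpha> m n\<close> is the coefficient of \<open>(-l)\<^sup>m\<close> in \<open>s\<^sub>n\<close>, obtained by iterating the summed
  equation.
\<close>

primrec solution_coeff :: "real \<Rightarrow> nat \<Rightarrow> nat \<Rightarrow> real" where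
  "solution_coeff \<alpha> 0 = (\<lambda>n. 1)"
| "solution_coeff \<alpha> (Suc m) = (\<lambda>n. \<Sum>k<n.
     (\<Sum>j\<le>k. laguerre_mass \<alpha> j * solution_coeff \<alpha> m j) / laguerre_mass \<alpha> (Suc k))"

definition solution :: "real \<Rightarrow> real \<Rightarrow> nat \<Rightarrow> real" where
  "solution \<alpha> l n = (\<Sum>m\<le>n. (- l) ^ m * solution_coeff \<alpha> m n)"

lemma solution_coeff_eq_0: "n < m \<Longrightarrow> solution_coeff \<alpha> m n = 0"
  by (induction m arbitrary: n) (auto intro!: sum.neutral)

lemma solution_alt:
  assumes "n \<le> N"
  shows "solution \<alpha> l n = (\<Sum>m\<le>N. (- l) ^ m * solution_coeff \<alpha> m n)"
  unfolding solution_def using assms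
  by (intro sum.mono_neutral_left) (auto simp: solution_coeff_eq_0)

lemma solution_at_0 [simp]: "solution \<alpha> 0 n = 1"
  by (simp add: solution_def power_0_left if_distrib[of "\<lambda>x. x * _"] cong: if_cong)

lemma solution_0 [simp]: "solution \<alpha> l 0 = 1"
  by (simp add: solution_def)

text \<open>
  The eigenvalue equation of the discrete problem in summed form; the flux through the left end
  is zero.
\<close>

lemma solution_flux:
  assumes "\<alpha> > -1"
  shows "laguerre_mass \<alpha> (Suc k) * (solution \<alpha> l k - solution \<alpha> l (Suc k))
       = l * (\<Sum>j\<le>k. laguerre_mass \<alpha> j * solution \<alpha> l j)"
proof -
  let ?M = "laguerre_mass \<alpha>" and ?b = "solution_coeff \<alpha>"
  have M: "?M (Suc k) \<noteq> 0" using laguerre_mass_pos[OF assms, of "Suc k"] by simp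
  have "solution \<alpha> l k - solution \<alpha> l (Suc k)
      = (\<Sum>m\<le>Suc k. (- l) ^ m * (?b m k - ?b m (Suc k)))"
    by (simp add: solution_alt[of _ "Suc k"] right_diff_distrib sum_subtractf del: sum.atMost_Suc)
  also have "\<dots> = (\<Sum>m\<le>k. (- l) ^ Suc m * (?b (Suc m) k - ?b (Suc m) (Suc k)))"
    by (simp add: sum.atMost_Suc_shift del: sum.atMost_Suc solution_coeff.simps(2))
  also have "\<dots> = (\<Sum>m\<le>k. l / ?M (Suc k) * (\<Sum>j\<le>k. ?M j * ((- l) ^ m * ?b m j)))"
  proof (intro sum.cong refl)
    fix m
    have "?b (Suc m) k - ?b (Suc m) (Suc k) = - (\<Sum>j\<le>k. ?M j * ?b m j) / ?M (Suc k)" by simp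
    moreover have "(\<Sum>j\<le>k. ?M j * ((- l) ^ m * ?b m j)) = (- l) ^ m * (\<Sum>j\<le>k. ?M j * ?b m j)"
      by (simp add: sum_distrib_left mult_ac)
    ultimately show "(- l) ^ Suc m * (?b (Suc m) k - ?b (Suc m) (Suc k))
        = l / ?M (Suc k) * (\<Sum>j\<le>k. ?M j * ((- l) ^ m * ?b m j))"
      by (simp only:) (simp add: field_simps)
  qed
  also have "\<dots> = l / ?M (Suc k) * (\<Sum>m\<le>k. \<Sum>j\<le>k. ?M j * ((- l) ^ m * ?b m j))"
    by (simp add: sum_distrib_left)
  also have "(\<Sum>m\<le>k. \<Sum>j\<le>k. ?M j * ((- l) ^ m * ?b m j)) = (\<Sum>j\<le>k. ?M j * solution \<alpha> l j)"
    by (subst sum.swap) (simp add: solution_alt[of _ k] sum_distrib_left)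
  finally show ?thesis using M by simp
qed

lemma continuous_on_solution [continuous_intros]: "continuous_on A (\<lambda>l. solution \<alpha> l n)"
  unfolding solution_def by (intro continuous_intros)

lemma first_zero:
  fixes f :: "real \<Rightarrow> real"
  assumes "continuous_on {0..x} f" "0 \<le> x" "f 0 > 0" "f x \<le> 0"
  obtains z where "0 < z" "z \<le> x" "f z = 0" "\<And>t. 0 \<le> t \<Longrightarrow> t < z \<Longrightarrow> f t > 0"
proof -
  define Z where "Z = {t \<in> {0..x}. f t = 0}"
  have ivt: "\<exists>s\<in>Z. s \<le> t" if "0 \<le> t" "t \<le> x" "f t \<le> 0" for t
    using IVT2'[of f t 0 0] that assms continuous_on_subset[OF assms(1), of "{0..t}"]
    by (fastforce simp: Z_def)
  have "closed Z" unfolding Z_def using assms(1) by (intro continuous_closed_preimage_constant) auto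
  moreover have "bounded Z"
    by (rule bounded_subset[of "{0..x}"]) (auto simp: Z_def)
  ultimately have "compact Z" by (simp add: compact_eq_bounded_closed)
  moreover have "Z \<noteq> {}" using ivt[of x] assms by auto
  ultimately obtain z where z: "z \<in> Z" "\<And>t. t \<in> Z \<Longrightarrow> z \<le> t"
    using compact_attains_inf[of Z] by blast
  show ?thesis
  proof (rule that)
    show "0 < z" using z(1) assms(3) by (cases "z = 0") (auto simp: Z_def)
    show "z \<le> x" "f z = 0" using z(1) by (auto simp: Z_def)
    show "f t > 0" if "0 \<le> t" "t < z" for t
    proof (rule ccontr)
      assume "\<not> f t > 0"
      hence "\<exists>s\<in>Z. s \<le> t" using ivt[of t] that \<open>z \<le> x\<close> by simp
      then obtain s where "s \<in> Z" "s \<le> t" by blast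
      thus False using z(2)[of s] that by simp
    qed
  qed
qed

text \<open>
  The first zero of \<open>l \<mapsto> s\<^sub>n(l)\<close> moves left as \<open>n\<close> grows: at the first zero of \<open>s\<^sub>n\<close> all earlier terms
  are still nonnegative, so the flux is nonnegative and \<open>s\<^sub>n\<^sub>+\<^sub>1 \<le> s\<^sub>n = 0\<close> there.
\<close>

lemma solution_pos_earlier:
  assumes "\<alpha> > -1" "\<And>l. 0 \<le> l \<Longrightarrow> l \<le> L \<Longrightarrow> solution \<alpha> l n > 0"
    and "k \<le> n" "0 \<le> l" "l \<le> L"
  shows "solution \<alpha> l k > 0"
  using assms(2-)
proof (induction n arbitrary: L l k)
  case (Suc n)
  have n: "solution \<alpha> l n > 0" if l: "0 \<le> l" "l \<le> L" for l
  proof (rule ccontr)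
    assume "\<not> solution \<alpha> l n > 0"
    then obtain z where z: "0 < z" "z \<le> l" "solution \<alpha> z n = 0"
      and pos: "\<And>t. 0 \<le> t \<Longrightarrow> t < z \<Longrightarrow> solution \<alpha> t n > 0"
      using first_zero[of l "\<lambda>l. solution \<alpha> l n"] l by (auto intro: continuous_on_solution)
    have nonneg: "solution \<alpha> z j \<ge> 0" if "j \<le> n" for j
    proof (rule ccontr)
      assume neg: "\<not> solution \<alpha> z j \<ge> 0"
      then obtain y where y: "0 < y" "y \<le> z" "solution \<alpha> y j = 0"
        using first_zero[of z "\<lambda>l. solution \<alpha> l j"] z(1) by (auto intro: continuous_on_solution)
      hence "y < z" using neg by (cases "y = z") auto
      have "solution \<alpha> y j > 0"
        by (rule Suc.IH[of y]) (use pos \<open>y < z\<close> y that in auto)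
      thus False using y by simp
    qed
    have "laguerre_mass \<alpha> (Suc n) * (0 - solution \<alpha> z (Suc n))
        = z * (\<Sum>j\<le>n. laguerre_mass \<alpha> j * solution \<alpha> z j)"
      using solution_flux[OF assms(1), of n z] z(3) by simp
    also have "\<dots> \<ge> 0"
      using z(1) nonneg laguerre_mass_pos[OF assms(1)]
      by (intro mult_nonneg_nonneg sum_nonneg) (auto intro: less_imp_le)
    finally have "solution \<alpha> z (Suc n) \<le> 0"
      using laguerre_mass_pos[OF assms(1), of "Suc n"] by (simp add: mult_le_0_iff)
    moreover have "solution \<alpha> z (Suc n) > 0" using Suc.prems(1)[of z] z l by simp
    ultimately show False by simp
  qed
  show ?case
  proof (cases "k = Suc n")
    case True
    thus ?thesis using Suc.prems by simp
  next
    case False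
    show ?thesis by (rule Suc.IH[of L]) (use n False Suc.prems in auto)
  qed
qed simp

text \<open>
  For positive \<open>s\<close>, \<open>(v\<^sub>k - v\<^sub>k\<^sub>+\<^sub>1)\<^sup>2 \<ge> (s\<^sub>k - s\<^sub>k\<^sub>+\<^sub>1) (v\<^sub>k\<^sup>2 / s\<^sub>k - v\<^sub>k\<^sub>+\<^sub>1\<^sup>2 / s\<^sub>k\<^sub>+\<^sub>1)\<close>, the difference being a
  square. Multiplied by \<open>M\<^sub>k\<^sub>+\<^sub>1\<close> and summed by parts, the right-hand sides collapse to
  \<open>l (\<Sum>k<n. M\<^sub>k v\<^sub>k\<^sup>2)\<close> by the difference equation for \<open>s\<close>.
\<close>

lemma discrete_picone:
  fixes v :: "nat \<Rightarrow> real"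
  assumes "\<alpha> > -1" "\<And>k. k \<le> n \<Longrightarrow> solution \<alpha> l k > 0" "v n = 0"
  shows "l * (\<Sum>k<n. laguerre_mass \<alpha> k * (v k)\<^sup>2)
       \<le> (\<Sum>k<n. laguerre_mass \<alpha> (Suc k) * (v k - v (Suc k))\<^sup>2)"
proof -
  let ?M = "laguerre_mass \<alpha>"
  define s where "s = solution \<alpha> l"
  define g where "g = (\<lambda>m. l * (\<Sum>j<m. ?M j * s j))"
  have "l * (\<Sum>k<m. ?M k * (v k)\<^sup>2)
       \<le> (\<Sum>k<m. ?M (Suc k) * (v k - v (Suc k))\<^sup>2) + g m * (v m)\<^sup>2 / s m" if "m \<le> n" for m
    using that
  proof (induction m)
    case 0
    show ?case by (simp add: g_def)
  next
    case (Suc m)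
    have s: "s m > 0" "s (Suc m) > 0" using Suc.prems assms(2) by (auto simp: s_def)
    have g1: "g (Suc m) = g m + l * (?M m * s m)" by (simp add: g_def algebra_simps)
    have g2: "?M (Suc m) * (s m - s (Suc m)) = g (Suc m)"
      using solution_flux[OF assms(1), of m l] by (simp add: s_def g_def lessThan_Suc_atMost)
    have "(v m - v (Suc m))\<^sup>2 - (s m - s (Suc m)) * ((v m)\<^sup>2 / s m - (v (Suc m))\<^sup>2 / s (Suc m))
        = (s (Suc m) * v m - s m * v (Suc m))\<^sup>2 / (s m * s (Suc m))"
      using s by (simp add: field_simps power2_eq_square)
    also have "\<dots> \<ge> 0" using s by simp
    finally have "?M (Suc m) * ((s m - s (Suc m)) * ((v m)\<^sup>2 / s m - (v (Suc m))\<^sup>2 / s (Suc m)))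
      \<le> ?M (Suc m) * (v m - v (Suc m))\<^sup>2"
      using laguerre_mass_pos[OF assms(1), of "Suc m"] by (intro mult_left_mono) auto
    hence "g (Suc m) * ((v m)\<^sup>2 / s m - (v (Suc m))\<^sup>2 / s (Suc m)) \<le> ?M (Suc m) * (v m - v (Suc m))\<^sup>2"
      unfolding g2[symmetric] by (simp only: mult.assoc)
    moreover have "g (Suc m) * ((v m)\<^sup>2 / s m) = g m * (v m)\<^sup>2 / s m + l * (?M m * (v m)\<^sup>2)"
      unfolding g1 using s by (simp add: field_simps)
    ultimately show ?case using Suc by (simp add: algebra_simps)
  qed
  from this[of n] show ?thesis using assms(3) by simp
qed

text \<open>
  The equality case \<open>v = s\<close> of the same summation by parts: the vanishing end value makes \<open>s\<close>
  itself admissible.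
\<close>

lemma solution_rayleigh:
  assumes "\<alpha> > -1" "solution \<alpha> l n = 0"
  shows "(\<Sum>k<n. laguerre_mass \<alpha> (Suc k) * (solution \<alpha> l k - solution \<alpha> l (Suc k))\<^sup>2)
       = l * (\<Sum>k<n. laguerre_mass \<alpha> k * (solution \<alpha> l k)\<^sup>2)"
proof -
  let ?M = "laguerre_mass \<alpha>"
  define s where "s = solution \<alpha> l"
  define g where "g = (\<lambda>m. l * (\<Sum>j<m. ?M j * s j))"
  have "(\<Sum>k<m. ?M (Suc k) * (s k - s (Suc k))\<^sup>2) + g m * s m = l * (\<Sum>k<m. ?M k * (s k)\<^sup>2)" for m
  proof (induction m)
    case (Suc m)
    have g1: "g (Suc m) = g m + l * (?M m * s m)" by (simp add: g_def algebra_simps)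
    have g2: "?M (Suc m) * (s m - s (Suc m)) = g (Suc m)"
      using solution_flux[OF assms(1), of m l] by (simp add: s_def g_def lessThan_Suc_atMost)
    have "?M (Suc m) * (s m - s (Suc m))\<^sup>2 + g (Suc m) * s (Suc m) = g (Suc m) * s m"
      unfolding g2[symmetric] by (simp add: power2_eq_square algebra_simps)
    also have "\<dots> = g m * s m + l * (?M m * (s m)\<^sup>2)"
      unfolding g1 by (simp add: power2_eq_square algebra_simps)
    finally show ?case using Suc by (simp add: algebra_simps)
  qed (simp add: g_def)
  from this[of n] show ?thesis using assms(2) by (simp add: s_def)
qed

lemma markov_quotient_le:
  assumes "\<alpha> > -1" "l > 0" "\<And>k. k \<le> n \<Longrightarrow> solution \<alpha> l k > 0" "degree p \<le> n"
  shows "laguerre_norm \<alpha> (poly (pderiv p)) / laguerre_norm \<alpha> (poly p) \<le> 1 / sqrt l"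
proof -
  let ?E = "weighted_integral \<alpha>"
  obtain v where v: "v n = 0"
    "?E (pderiv p * pderiv p) = Gamma (\<alpha> + 1) * (\<Sum>k<n. laguerre_mass \<alpha> k * (v k)\<^sup>2)"
    "?E (p * p) \<ge> Gamma (\<alpha> + 1) * (\<Sum>k<n. laguerre_mass \<alpha> (Suc k) * (v k - v (Suc k))\<^sup>2)"
    using poly_tail_sums[OF assms(1,4)] by blast
  have G: "Gamma (\<alpha> + 1) > 0" using assms(1) by simp
  have "l * ?E (pderiv p * pderiv p) = Gamma (\<alpha> + 1) * (l * (\<Sum>k<n. laguerre_mass \<alpha> k * (v k)\<^sup>2))"
    unfolding v(2) by (simp only: ac_simps)
  also have "\<dots> \<le> ?E (p * p)"
    by (rule order_trans[OF mult_left_mono v(3)])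
       (use discrete_picone[of \<alpha> n l v, OF assms(1,3) v(1)] G in auto)
  finally have *: "?E (pderiv p * pderiv p) \<le> ?E (p * p) / l" using assms(2) by (simp add: field_simps)
  have "laguerre_norm \<alpha> (poly (pderiv p)) \<le> laguerre_norm \<alpha> (poly p) / sqrt l"
    unfolding laguerre_norm_poly real_sqrt_divide[symmetric] using * by simp
  moreover have "?E (pderiv p * pderiv p) \<ge> 0"
    unfolding v(2) using G laguerre_mass_pos[OF assms(1)]
    by (intro mult_nonneg_nonneg sum_nonneg) (auto intro: less_imp_le)
  hence "laguerre_norm \<alpha> (poly p) \<ge> 0"
    using * assms(2) by (auto simp: laguerre_norm_poly zero_le_divide_iff dest: order_trans)
  ultimately show ?thesis using assms(2) by (cases "laguerre_norm \<alpha> (poly p) = 0") (auto simp: field_simps)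
qed

lemma markov_quotient_attained:
  assumes "\<alpha> > -1" "l > 0" "solution \<alpha> l n = 0"
  obtains p where "degree p \<le> n" "p \<noteq> 0"
    "laguerre_norm \<alpha> (poly (pderiv p)) / laguerre_norm \<alpha> (poly p) = 1 / sqrt l"
proof -
  let ?E = "weighted_integral \<alpha>"
  define p where "p = (\<Sum>k<n. smult (solution \<alpha> l k - solution \<alpha> l (Suc k)) (laguerre \<alpha> (Suc k)))"
  note q = markov_quadratic_forms[of \<alpha> "solution \<alpha> l" n, OF assms(1,3), folded p_def]
  have E: "?E (p * p) = l * ?E (pderiv p * pderiv p)"
    unfolding q(3,4) solution_rayleigh[OF assms(1,3)] by simp
  have n: "n > 0" using assms(3) by (cases n) auto
  have "(\<Sum>k<n. laguerre_mass \<alpha> k * (solution \<alpha> l k)\<^sup>2) > 0"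
    by (rule sum_pos2[of _ 0])
       (use n laguerre_mass_pos[OF assms(1)] assms(1) in
         \<open>auto intro!: mult_nonneg_nonneg less_imp_le[OF laguerre_mass_pos]\<close>)
  hence pos: "?E (pderiv p * pderiv p) > 0" unfolding q(3) using assms(1) by simp
  show ?thesis
  proof (rule that)
    show "degree p \<le> n" by (rule q(1))
    show "p \<noteq> 0" using pos by auto
    show "laguerre_norm \<alpha> (poly (pderiv p)) / laguerre_norm \<alpha> (poly p) = 1 / sqrt l"
      unfolding laguerre_norm_poly E using pos assms(2) by (simp add: real_sqrt_mult)
  qed
qed

lemma markov_const_le:
  assumes "\<alpha> > -1" "l > 0" "\<And>t. 0 \<le> t \<Longrightarrow> t \<le> l \<Longrightarrow> solution \<alpha> t n > 0"
  shows "bdd_above {laguerre_norm \<alpha> (poly (pderiv p)) / laguerre_norm \<alpha> (poly p) | p :: real poly.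
            degree p \<le> n \<and> p \<noteq> 0}" (is "bdd_above ?S")
    and "markov_const n \<alpha> \<le> 1 / sqrt l"
proof -
  have pos: "solution \<alpha> l k > 0" if "k \<le> n" for k
    using solution_pos_earlier[OF assms(1), of l n k l] assms(2,3) that by auto
  have le: "x \<le> 1 / sqrt l" if "x \<in> ?S" for x
    using that markov_quotient_le[OF assms(1,2) pos] by blast
  thus "bdd_above ?S" by (rule bdd_aboveI)
  have "?S \<noteq> {}" by (auto intro!: exI[of _ 1])
  thus "markov_const n \<alpha> \<le> 1 / sqrt l"
    unfolding markov_const_def using le by (rule cSup_least)
qed

lemma markov_const_ge:
  assumes "\<alpha> > -1" "l > 0" "\<And>t. 0 \<le> t \<Longrightarrow> t \<le> l \<Longrightarrow> solution \<alpha> t n > 0"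
    and "u > 0" "solution \<alpha> u n \<le> 0"
  shows "markov_const n \<alpha> \<ge> 1 / sqrt u"
proof -
  obtain z where z: "0 < z" "z \<le> u" "solution \<alpha> z n = 0"
    using first_zero[of u "\<lambda>l. solution \<alpha> l n"] assms(4,5) by (auto intro: continuous_on_solution)
  obtain p where p: "degree p \<le> n" "p \<noteq> 0"
    "laguerre_norm \<alpha> (poly (pderiv p)) / laguerre_norm \<alpha> (poly p) = 1 / sqrt z"
    using markov_quotient_attained[OF assms(1) z(1,3)] by blast
  have "1 / sqrt u \<le> 1 / sqrt z" using z by (intro divide_left_mono) auto
  also have "1 / sqrt z \<le> markov_const n \<alpha>"
    unfolding markov_const_def
    by (rule cSup_upper[OF _ markov_const_le(1)[OF assms(1-3)]])
       (use p in \<open>auto intro!: exI[of _ p]\<close>)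
  finally show ?thesis .
qed

section \<open>The continuum limit\<close>

text \<open>
  With \<open>\<nu> = (\<alpha> - 1) / 2\<close> the denominators are \<open>4 (i + 1) (\<nu> + 1 + i)\<close>, so these are the absolute
  values of the Taylor coefficients of \<open>\<Gamma>(\<nu> + 1) (\<surd>t / 2)\<^sup>-\<^sup>\<nu> J\<^sub>\<nu>(\<surd>t)\<close>.
\<close>

definition bessel_coeff :: "real \<Rightarrow> nat \<Rightarrow> real" where
  "bessel_coeff \<alpha> m = (\<Prod>i<m. 1 / (2 * real (Suc i) * (\<alpha> + 1 + 2 * real i)))"

lemma bessel_coeff_0 [simp]: "bessel_coeff \<alpha> 0 = 1"
  by (simp add: bessel_coeff_def)

lemma bessel_coeff_Suc:
  "bessel_coeff \<alpha> (Suc m) = bessel_coeff \<alpha> m / (2 * real (Suc m) * (\<alpha> + 1 + 2 * real m))"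
  by (simp add: bessel_coeff_def)

lemma Suc_times_binomial_real:
  "real (Suc r) * real (n choose Suc r) = (real n - real r) * real (n choose r)"
  using gbinomial_mult_1[of "real n" r] by (simp add: binomial_gbinomial algebra_simps)

lemma binomial_over_power_tendsto: "(\<lambda>n. real (n choose r) / real n ^ r) \<longlonglongrightarrow> 1 / fact r"
proof (induction r)
  case 0
  show ?case by simp
next
  case (Suc r)
  have "(\<lambda>n. real (n choose r) / real n ^ r * ((1 - real r / real n) / real (Suc r)))
     \<longlonglongrightarrow> 1 / fact r * ((1 - 0) / real (Suc r))"
    by (intro tendsto_intros Suc.IH lim_const_over_n) simp
  moreover have "\<forall>\<^sub>F n in sequentially. real (n choose r) / real n ^ r * ((1 - real r / real n) / real (Suc r))
      = real (n choose Suc r) / real n ^ Suc r"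
    using eventually_gt_at_top[of 0]
  proof eventually_elim
    case (elim n)
    have "real (n choose Suc r) = (real n - real r) * real (n choose r) / real (Suc r)"
      by (subst Suc_times_binomial_real[symmetric]) simp
    thus ?case using elim by (simp add: divide_simps) 
  qed
  ultimately show ?case by (simp add: filterlim_cong[OF refl refl] tendsto_cong mult.commute)
qed

text \<open>
  The sum telescopes, because up to a constant \<open>M\<^sub>j (j choose r)\<close> is the quotient
  \<open>\<Gamma>(j + \<alpha> + 1) / \<Gamma>(j - r + 1)\<close>. This makes the binomial basis the one in which the recursion for \<open>solution_coeff\<close> is explicit.
\<close>

lemma mass_binomial_sum:
  assumes "\<alpha> > -1"
  shows "(\<Sum>j<k. laguerre_mass \<alpha> j * real (j choose r))
       = laguerre_mass \<alpha> k * (real (Suc r) * real (k choose Suc r)) / (\<alpha> + 1 + real r)"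
proof (induction k)
  case (Suc k)
  have a: "\<alpha> + 1 + real r \<noteq> 0" using assms by simp
  have "real (Suc r) * real (Suc k choose Suc r) = real (Suc k) * real (k choose r)"
    using Suc_times_binomial_eq[of k r] by (metis of_nat_mult mult.commute)
  hence "laguerre_mass \<alpha> (Suc k) * (real (Suc r) * real (Suc k choose Suc r))
      = (real (Suc k) * laguerre_mass \<alpha> (Suc k)) * real (k choose r)" by (simp only: ac_simps)
  also have "\<dots> = laguerre_mass \<alpha> k * ((real k - real r) * real (k choose r))
      + (\<alpha> + 1 + real r) * (laguerre_mass \<alpha> k * real (k choose r))"
    unfolding laguerre_mass_Suc by (simp add: algebra_simps)
  finally show ?case
    using a Suc by (simp only: sum.lessThan_Suc Suc_times_binomial_real) (simp add: field_simps)
qed simp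

lemma solution_step_binomial:
  assumes "\<alpha> > -1"
  shows "(\<Sum>k<n. (\<Sum>j\<le>k. laguerre_mass \<alpha> j * real (j choose r)) / laguerre_mass \<alpha> (Suc k))
       = real (Suc r) / (\<alpha> + 1 + real r) * (real (n choose Suc (Suc r)) + real (n choose Suc r))"
proof (induction n)
  case (Suc n)
  have "(\<Sum>j\<le>n. laguerre_mass \<alpha> j * real (j choose r)) / laguerre_mass \<alpha> (Suc n)
      = real (Suc r) / (\<alpha> + 1 + real r) * real (Suc n choose Suc r)"
    unfolding lessThan_Suc_atMost[symmetric] mass_binomial_sum[OF assms]
    using laguerre_mass_pos[OF assms, of "Suc n"] by simp
  moreover have "real (Suc n choose Suc (Suc r)) = real (n choose Suc r) + real (n choose Suc (Suc r))"
    by simp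
  ultimately show ?case
    by (simp only: sum.lessThan_Suc Suc.IH distrib_left add_ac)
qed simp

text \<open>
  Each step of the recursion raises the degree in \<open>n\<close> by two; only the leading coefficient matters
  for the scaling limit.
\<close>

lemma solution_coeff_binomial_expansion:
  assumes "\<alpha> > -1"
  shows "\<exists>c. c (2 * m) = fact (2 * m) * bessel_coeff \<alpha> m \<and>
    (\<forall>n. solution_coeff \<alpha> m n = (\<Sum>r\<le>2*m. c r * real (n choose r)))"
proof (induction m)
  case 0
  show ?case by (intro exI[of _ "\<lambda>_. 1"]) simp
next
  case (Suc m)
  then obtain c where c: "c (2 * m) = fact (2 * m) * bessel_coeff \<alpha> m"
    "\<And>n. solution_coeff \<alpha> m n = (\<Sum>r\<le>2*m. c r * real (n choose r))" by blast
  define d where "d = (\<lambda>r. c r * (real (Suc r) / (\<alpha> + 1 + real r)))"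
  define e where "e = (\<lambda>r. (if 2 \<le> r then d (r - 2) else 0) + (if 1 \<le> r \<and> r \<le> Suc (2 * m) then d (r - 1) else 0))"
  show ?case
  proof (intro exI[of _ e] conjI allI)
    have "e (2 * Suc m) = d (2 * m)" by (simp add: e_def)
    also have "\<dots> = fact (2 * Suc m) * bessel_coeff \<alpha> (Suc m)"
    proof -
      have "\<alpha> + 1 + 2 * real m \<noteq> 0" using assms by (smt (verit) of_nat_0_le_iff)
      thus ?thesis by (simp add: d_def c(1) bessel_coeff_Suc divide_simps)
    qed
    finally show "e (2 * Suc m) = fact (2 * Suc m) * bessel_coeff \<alpha> (Suc m)" .
  next
    fix n
    have "solution_coeff \<alpha> (Suc m) n = (\<Sum>k<n. \<Sum>r\<le>2*m. c r *
        ((\<Sum>j\<le>k. laguerre_mass \<alpha> j * real (j choose r)) / laguerre_mass \<alpha> (Suc k)))"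
    proof -
      have "(\<Sum>j\<le>k. laguerre_mass \<alpha> j * solution_coeff \<alpha> m j) =
        (\<Sum>r\<le>2*m. c r * (\<Sum>j\<le>k. laguerre_mass \<alpha> j * real (j choose r)))" for k
        unfolding c(2) sum_distrib_left
        by (subst sum.swap) (simp add: mult_ac)
      hence "(\<Sum>j\<le>k. laguerre_mass \<alpha> j * solution_coeff \<alpha> m j) / laguerre_mass \<alpha> (Suc k) =
        (\<Sum>r\<le>2*m. c r * ((\<Sum>j\<le>k. laguerre_mass \<alpha> j * real (j choose r)) / laguerre_mass \<alpha> (Suc k)))" for k
        by (simp only: sum_divide_distrib[of _ "{..2*m}"] times_divide_eq_right)
      thus ?thesis by simp
    qed
    also have "\<dots> = (\<Sum>r\<le>2*m. c r * (\<Sum>k<n. (\<Sum>j\<le>k. laguerre_mass \<alpha> j * real (j choose r)) / laguerre_mass \<alpha> (Suc k)))"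
      by (subst sum.swap) (simp add: sum_distrib_left)
    also have "\<dots> = (\<Sum>r\<le>2*m. d r * real (n choose Suc (Suc r))) + (\<Sum>r\<le>2*m. d r * real (n choose Suc r))"
      unfolding solution_step_binomial[OF assms]
      by (simp only: d_def mult.assoc[symmetric] distrib_left sum.distrib)
    also have "(\<Sum>r\<le>2*m. d r * real (n choose Suc (Suc r)))
       = (\<Sum>r\<le>Suc (Suc (2*m)). (if 2 \<le> r then d (r - 2) else 0) * real (n choose r))"
      by (simp add: sum.atMost_Suc_shift del: sum.atMost_Suc)
    also have "(\<Sum>r\<le>2*m. d r * real (n choose Suc r))
       = (\<Sum>r\<le>Suc (Suc (2*m)). (if 1 \<le> r \<and> r \<le> Suc (2 * m) then d (r - 1) else 0) * real (n choose r))"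
      by (subst sum.atMost_Suc, subst sum.atMost_Suc_shift) simp
    finally show "solution_coeff \<alpha> (Suc m) n = (\<Sum>r\<le>2 * Suc m. e r * real (n choose r))"
      by (simp only: e_def distrib_right sum.distrib) simp
  qed
qed

lemma solution_coeff_tendsto:
  assumes "\<alpha> > -1"
  shows "(\<lambda>n. solution_coeff \<alpha> m n / real n ^ (2 * m)) \<longlonglongrightarrow> bessel_coeff \<alpha> m"
proof -
  obtain c where c: "c (2 * m) = fact (2 * m) * bessel_coeff \<alpha> m"
    "\<And>n. solution_coeff \<alpha> m n = (\<Sum>r\<le>2*m. c r * real (n choose r))"
    using solution_coeff_binomial_expansion[OF assms] by blast
  have lim: "(\<lambda>n. real (n choose r) / real n ^ (2 * m)) \<longlonglongrightarrow> (if r = 2 * m then 1 / fact r else 0)"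
    if "r \<le> 2 * m" for r
  proof (cases "r = 2 * m")
    case True
    thus ?thesis using binomial_over_power_tendsto[of r] by simp
  next
    case False
    define i where "i = 2 * m - Suc r"
    have i: "2 * m = r + Suc i" using False that by (simp add: i_def)
    have "(\<lambda>n. real (n choose r) / real n ^ r * (1 / real n) ^ Suc i) \<longlonglongrightarrow> 1 / fact r * 0 ^ Suc i"
      by (intro tendsto_intros binomial_over_power_tendsto lim_1_over_n)
    thus ?thesis using False unfolding i by (simp add: power_add power_divide mult_ac)
  qed
  have "(\<lambda>n. \<Sum>r\<le>2*m. c r * (real (n choose r) / real n ^ (2 * m)))
     \<longlonglongrightarrow> (\<Sum>r\<le>2*m. c r * (if r = 2 * m then 1 / fact r else 0))"
    by (intro tendsto_intros lim) simp
  also have "(\<Sum>r\<le>2*m. c r * (if r = 2 * m then 1 / fact r else 0)) = bessel_coeff \<alpha> m"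
    using c(1) by (simp add: if_distrib[of "\<lambda>x. _ * x"] sum.delta cong: if_cong)
  finally show ?thesis unfolding c(2) by (simp add: sum_divide_distrib)
qed

lemma solution_coeff_nonneg_mono:
  assumes "\<alpha> > -1"
  shows "solution_coeff \<alpha> m n \<ge> 0 \<and> (\<forall>j\<le>n. solution_coeff \<alpha> m j \<le> solution_coeff \<alpha> m n)"
proof (induction m arbitrary: n)
  case (Suc m)
  have "(\<Sum>j\<le>k. laguerre_mass \<alpha> j * solution_coeff \<alpha> m j) / laguerre_mass \<alpha> (Suc k) \<ge> 0" for k
    using Suc laguerre_mass_pos[OF assms]
    by (intro divide_nonneg_pos sum_nonneg mult_nonneg_nonneg) (auto intro: less_imp_le)
  thus ?case by (auto intro!: sum_nonneg sum_mono2)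
qed simp

lemma power_Suc_increment:
  fixes y :: real
  assumes "y \<ge> 0"
  shows "y ^ Suc N + real (Suc N) * y ^ N \<le> (y + 1) ^ Suc N"
proof (induction N)
  case (Suc N)
  have "y ^ Suc (Suc N) + real (Suc (Suc N)) * y ^ Suc N
     \<le> (y + 1) * (y ^ Suc N + real (Suc N) * y ^ N)"
    using assms by (simp add: algebra_simps)
  also have "\<dots> \<le> (y + 1) * (y + 1) ^ Suc N"
    using assms Suc by (intro mult_left_mono) auto
  finally show ?case by simp
qed simp

text \<open>
  The scaling limit is taken termwise in a power series, which needs a bound that is uniform in
  \<open>n\<close> and summable in \<open>m\<close>. The shift \<open>n + m\<close> lets the induction step be an increment estimate for
  \<open>y \<mapsto> y\<^bsup>2m + 2\<^esup>\<close>; it costs only a factor \<open>4\<^sup>m\<close>, as the coefficients vanish for \<open>m > n\<close>.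
\<close>

lemma solution_coeff_le:
  assumes "\<alpha> > -1"
  shows "solution_coeff \<alpha> m n \<le> real (n + m) ^ (2 * m) / ((\<alpha> + 1) ^ m * fact m)"
proof (induction m arbitrary: n)
  case (Suc m)
  let ?b = "solution_coeff \<alpha>"
  define K where "K = (\<alpha> + 1) ^ Suc m * fact m"
  have K: "K > 0" using assms by (simp add: K_def)
  have summand: "(\<Sum>j\<le>k. laguerre_mass \<alpha> j * ?b m j) / laguerre_mass \<alpha> (Suc k)
      \<le> real (Suc k) * real (k + m) ^ (2 * m) / K" for k
  proof -
    have "(\<Sum>j\<le>k. laguerre_mass \<alpha> j * ?b m j) \<le> (\<Sum>j\<le>k. laguerre_mass \<alpha> j * ?b m k)"
      using solution_coeff_nonneg_mono[OF assms, of m k] laguerre_mass_pos[OF assms]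
      by (intro sum_mono mult_left_mono) (auto intro: less_imp_le)
    also have "\<dots> = ?b m k * (\<Sum>j<Suc k. laguerre_mass \<alpha> j * real (j choose 0))"
      by (simp add: sum_distrib_left lessThan_Suc_atMost mult_ac del: sum.lessThan_Suc)
    also have "\<dots> = laguerre_mass \<alpha> (Suc k) * (?b m k * (real (Suc k) / (\<alpha> + 1)))"
      unfolding mass_binomial_sum[OF assms] by simp
    finally have "(\<Sum>j\<le>k. laguerre_mass \<alpha> j * ?b m j) / laguerre_mass \<alpha> (Suc k)
        \<le> ?b m k * (real (Suc k) / (\<alpha> + 1))"
      using laguerre_mass_pos[OF assms, of "Suc k"] by (simp add: divide_le_eq mult_ac)
    also have "\<dots> \<le> real (k + m) ^ (2 * m) / ((\<alpha> + 1) ^ m * fact m) * (real (Suc k) / (\<alpha> + 1))"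
      using assms by (intro mult_right_mono Suc) auto
    finally show ?thesis by (simp add: K_def mult_ac)
  qed
  have sum_le: "real (Suc m) * (\<Sum>k<n. real (Suc k) * real (k + m) ^ (2 * m)) \<le> real (n + Suc m) ^ (2 * Suc m)"
  proof (induction n)
    case (Suc k)
    define y where "y = real (k + Suc m)"
    have "real (Suc m) * (real (Suc k) * real (k + m) ^ (2 * m)) \<le> real (Suc (Suc (2 * m))) * (y * y ^ (2 * m))"
      by (intro mult_mono power_mono) (auto simp: y_def)
    also have "\<dots> = real (Suc (Suc (2 * m))) * y ^ Suc (2 * m)" by simp
    finally have "real (Suc m) * (\<Sum>k<Suc k. real (Suc k) * real (k + m) ^ (2 * m))
       \<le> y ^ Suc (Suc (2 * m)) + real (Suc (Suc (2 * m))) * y ^ Suc (2 * m)"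
      using Suc by (simp only: sum.lessThan_Suc distrib_left y_def) simp
    also have "\<dots> \<le> (y + 1) ^ Suc (Suc (2 * m))"
      by (rule power_Suc_increment) (simp add: y_def)
    finally show ?case by (simp add: y_def add_ac)
  qed simp
  have "?b (Suc m) n \<le> (\<Sum>k<n. real (Suc k) * real (k + m) ^ (2 * m) / K)"
    unfolding solution_coeff.simps by (rule sum_mono) (rule summand)
  also have "\<dots> = real (Suc m) * (\<Sum>k<n. real (Suc k) * real (k + m) ^ (2 * m)) / (real (Suc m) * K)"
    by (simp add: sum_divide_distrib sum_distrib_left)
  also have "\<dots> \<le> real (n + Suc m) ^ (2 * Suc m) / (real (Suc m) * K)"
    using K by (intro divide_right_mono sum_le) auto
  also have "real (Suc m) * K = (\<alpha> + 1) ^ Suc m * fact (Suc m)"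
    by (simp add: K_def)
  finally show ?case .
qed simp

lemma scaled_solution_coeff_le:
  assumes "\<alpha> > -1" "n > 0"
  shows "solution_coeff \<alpha> m n / real n ^ (2 * m) \<le> (4 / (\<alpha> + 1)) ^ m / fact m"
proof (cases "m \<le> n")
  case True
  have "solution_coeff \<alpha> m n \<le> real (n + m) ^ (2 * m) / ((\<alpha> + 1) ^ m * fact m)"
    by (rule solution_coeff_le[OF assms(1)])
  also have "\<dots> \<le> (2 * real n) ^ (2 * m) / ((\<alpha> + 1) ^ m * fact m)"
    using True assms(1) by (intro divide_right_mono power_mono) auto
  also have "\<dots> = (4 / (\<alpha> + 1)) ^ m / fact m * real n ^ (2 * m)"
    by (simp add: power_mult power_mult_distrib power_divide)
  finally show ?thesis using assms(2) by (simp add: divide_le_eq)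
next
  case False
  thus ?thesis using assms by (simp add: solution_coeff_eq_0)
qed

lemma bessel_coeff_bounds:
  assumes "\<alpha> > -1"
  shows "0 < bessel_coeff \<alpha> m" "bessel_coeff \<alpha> m \<le> (4 / (\<alpha> + 1)) ^ m / fact m"
proof -
  have f: "\<alpha> + 1 + 2 * real i > 0" for i using assms by (smt (verit) of_nat_0_le_iff)
  show "0 < bessel_coeff \<alpha> m"
    unfolding bessel_coeff_def by (intro prod_pos) (simp add: f)
  have "\<forall>\<^sub>F n in sequentially. solution_coeff \<alpha> m n / real n ^ (2 * m) \<le> (4 / (\<alpha> + 1)) ^ m / fact m"
    using eventually_gt_at_top[of 0] by eventually_elim (rule scaled_solution_coeff_le[OF assms])
  thus "bessel_coeff \<alpha> m \<le> (4 / (\<alpha> + 1)) ^ m / fact m"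
    by (rule tendsto_upperbound[OF solution_coeff_tendsto[OF assms]]) simp
qed

definition bessel_series_coeff :: "real \<Rightarrow> nat \<Rightarrow> real" where
  "bessel_series_coeff \<alpha> m = (-1) ^ m * bessel_coeff \<alpha> m"

text \<open>
  The function \<open>F(t) = \<Gamma>(\<nu> + 1) (\<surd>t / 2)\<^sup>-\<^sup>\<nu> J\<^sub>\<nu>(\<surd>t)\<close>, \<open>\<nu> = (\<alpha> - 1) / 2\<close>, followed by its first two
  derivatives as power series.
\<close>

definition bessel_fun :: "real \<Rightarrow> real \<Rightarrow> real" where
  "bessel_fun \<alpha> t = (\<Sum>m. bessel_series_coeff \<alpha> m * t ^ m)"

definition bessel_fun' :: "real \<Rightarrow> real \<Rightarrow> real" where
  "bessel_fun' \<alpha> t = (\<Sum>m. diffs (bessel_series_coeff \<alpha>) m * t ^ m)"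

definition bessel_fun'' :: "real \<Rightarrow> real \<Rightarrow> real" where
  "bessel_fun'' \<alpha> t = (\<Sum>m. diffs (diffs (bessel_series_coeff \<alpha>)) m * t ^ m)"

lemma summable_bessel:
  assumes "\<alpha> > -1"
  shows "summable (\<lambda>m. bessel_series_coeff \<alpha> m * t ^ m)"
proof (rule summable_comparison_test')
  show "summable (\<lambda>m. (4 / (\<alpha> + 1) * \<bar>t\<bar>) ^ m / fact m)"
    using summable_exp[of "4 / (\<alpha> + 1) * \<bar>t\<bar>"] by (simp add: field_simps)
  show "norm (bessel_series_coeff \<alpha> m * t ^ m) \<le> (4 / (\<alpha> + 1) * \<bar>t\<bar>) ^ m / fact m" if "0 \<le> m" for m
    using mult_right_mono[OF bessel_coeff_bounds(2)[OF assms, of m], of "\<bar>t\<bar> ^ m"]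
      bessel_coeff_bounds(1)[OF assms, of m]
    by (simp add: bessel_series_coeff_def abs_mult power_abs power_mult_distrib power_divide)
qed

lemma bessel_fun_derivs:
  assumes "\<alpha> > -1"
  shows "(bessel_fun \<alpha> has_real_derivative bessel_fun' \<alpha> t) (at t)"
    and "(bessel_fun' \<alpha> has_real_derivative bessel_fun'' \<alpha> t) (at t)"
proof -
  have 1: "summable (\<lambda>m. diffs (bessel_series_coeff \<alpha>) m * t ^ m)" for t
    by (rule termdiff_converges_all[OF summable_bessel[OF assms]])
  show "(bessel_fun \<alpha> has_real_derivative bessel_fun' \<alpha> t) (at t)"
    unfolding bessel_fun_def [abs_def] bessel_fun'_def
    by (rule termdiffs_strong_converges_everywhere[OF summable_bessel[OF assms]])
  show "(bessel_fun' \<alpha> has_real_derivative bessel_fun'' \<alpha> t) (at t)"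
    unfolding bessel_fun'_def [abs_def] bessel_fun''_def
    by (rule termdiffs_strong_converges_everywhere[OF 1])
qed

lemma bessel_fun_0 [simp]: "bessel_fun \<alpha> 0 = 1"
  by (simp add: bessel_fun_def bessel_series_coeff_def)

lemma bessel_ode:
  assumes "\<alpha> > -1"
  shows "t * bessel_fun'' \<alpha> t + (\<alpha> + 1) / 2 * bessel_fun' \<alpha> t + bessel_fun \<alpha> t / 4 = 0"
proof -
  let ?c = "bessel_series_coeff \<alpha>"
  have 1: "summable (\<lambda>m. diffs ?c m * t ^ m)" for t
    by (rule termdiff_converges_all[OF summable_bessel[OF assms]])
  have 2: "summable (\<lambda>m. diffs (diffs ?c) m * t ^ m)"
    by (rule termdiff_converges_all[OF 1])
  define g where "g = (\<lambda>m. real m * diffs ?c m)"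
  have "(\<lambda>m. t * (diffs (diffs ?c) m * t ^ m)) sums (t * bessel_fun'' \<alpha> t)"
    unfolding bessel_fun''_def by (intro sums_mult summable_sums 2)
  hence "(\<lambda>m. g (Suc m) * t ^ Suc m) sums (t * bessel_fun'' \<alpha> t)"
    by (simp add: g_def diffs_def[of "diffs ?c"] mult_ac)
  hence "(\<lambda>m. g m * t ^ m) sums (t * bessel_fun'' \<alpha> t)"
    by (subst (asm) sums_Suc_iff) (simp add: g_def)
  moreover have "(\<lambda>m. (\<alpha> + 1) / 2 * (diffs ?c m * t ^ m)) sums ((\<alpha> + 1) / 2 * bessel_fun' \<alpha> t)"
    unfolding bessel_fun'_def by (intro sums_mult summable_sums 1)
  moreover have "(\<lambda>m. ?c m * t ^ m / 4) sums (bessel_fun \<alpha> t / 4)"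
    unfolding bessel_fun_def by (intro sums_divide summable_sums summable_bessel[OF assms])
  ultimately have "(\<lambda>m. g m * t ^ m + (\<alpha> + 1) / 2 * (diffs ?c m * t ^ m) + ?c m * t ^ m / 4) sums
     (t * bessel_fun'' \<alpha> t + (\<alpha> + 1) / 2 * bessel_fun' \<alpha> t + bessel_fun \<alpha> t / 4)"
    by (intro sums_add)
  moreover have "g m * t ^ m + (\<alpha> + 1) / 2 * (diffs ?c m * t ^ m) + ?c m * t ^ m / 4 = 0" for m
  proof -
    have "\<alpha> + 1 + 2 * real m > 0" using assms by (smt (verit) of_nat_0_le_iff)
    hence "diffs ?c m * (\<alpha> + 1 + 2 * real m) = - ?c m / 2"
      by (simp add: diffs_def bessel_series_coeff_def bessel_coeff_Suc divide_simps)
    hence "g m + (\<alpha> + 1) / 2 * diffs ?c m + ?c m / 4 = 0"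
      unfolding g_def by (simp add: field_simps)
    hence "(g m + (\<alpha> + 1) / 2 * diffs ?c m + ?c m / 4) * t ^ m = 0" by simp
    thus ?thesis by (simp add: algebra_simps)
  qed
  ultimately show ?thesis using sums_unique2[OF sums_zero] by simp
qed

text \<open>
  Tannery's theorem for the sum of \<open>\<bar>b m n - \<beta> m\<bar> T\<^sup>m\<close>, with \<open>b m n\<close> and \<open>\<beta> m\<close> the scaled and the
  limiting coefficients; this sum dominates the difference for all \<open>t\<close> in \<open>[0, T]\<close> at once.
\<close>

lemma scaled_solution_uniform_limit:
  assumes "\<alpha> > -1" "T \<ge> 0" "e > 0"
  shows "\<forall>\<^sub>F n in sequentially. \<forall>t\<in>{0..T}. \<bar>solution \<alpha> (t / (real n)\<^sup>2) n - bessel_fun \<alpha> t\<bar> < e"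
proof -
  define b where "b = (\<lambda>m n. solution_coeff \<alpha> m n / real n ^ (2 * m))"
  define M where "M = (\<lambda>m. (4 / (\<alpha> + 1) * T) ^ m / fact m)"
  have M: "summable M"
    using summable_exp[of "4 / (\<alpha> + 1) * T"] by (simp add: M_def field_simps)
  have b: "0 \<le> b m n" "b m n \<le> (4 / (\<alpha> + 1)) ^ m / fact m" if "n > 0" for m n
    using scaled_solution_coeff_le[OF assms(1) that] solution_coeff_nonneg_mono[OF assms(1)]
    by (auto simp: b_def)
  have bound: "norm (\<bar>b m n - bessel_coeff \<alpha> m\<bar> * T ^ m) \<le> M m" if "n > 0" for m n
  proof -
    have "\<bar>b m n - bessel_coeff \<alpha> m\<bar> \<le> (4 / (\<alpha> + 1)) ^ m / fact m"
      using b[OF that, of m] bessel_coeff_bounds[OF assms(1), of m] by linarith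
    from mult_right_mono[OF this, of "T ^ m"] assms(2) show ?thesis
      by (simp add: M_def abs_mult power_mult_distrib power_divide)
  qed
  define D where "D = (\<lambda>n. \<Sum>m. \<bar>b m n - bessel_coeff \<alpha> m\<bar> * T ^ m)"
  have "D \<longlonglongrightarrow> (\<Sum>m. \<bar>bessel_coeff \<alpha> m - bessel_coeff \<alpha> m\<bar> * T ^ m)"
    unfolding D_def
  proof (rule tannerys_theorem[THEN conjunct2, THEN conjunct2])
    show "(\<lambda>n. \<bar>b m n - bessel_coeff \<alpha> m\<bar> * T ^ m) \<longlonglongrightarrow> \<bar>bessel_coeff \<alpha> m - bessel_coeff \<alpha> m\<bar> * T ^ m" for m
      unfolding b_def by (intro tendsto_intros solution_coeff_tendsto assms)
    show "\<forall>\<^sub>F (m, n) in at_top \<times>\<^sub>F sequentially. norm (\<bar>b m n - bessel_coeff \<alpha> m\<bar> * T ^ m) \<le> M m"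
      using eventually_prodI[OF always_eventually eventually_gt_at_top[of 0], of "\<lambda>_. True" at_top]
      by (rule eventually_mono) (use bound in auto)
  qed (simp_all add: M)
  hence "D \<longlonglongrightarrow> 0" by simp
  hence "\<forall>\<^sub>F n in sequentially. D n < e" using assms(3) by (rule order_tendstoD)
  thus ?thesis using eventually_gt_at_top[of 0]
  proof eventually_elim
    case (elim n)
    show ?case
    proof
      fix t assume t: "t \<in> {0..T}"
      have "solution \<alpha> (t / (real n)\<^sup>2) n = (\<Sum>m\<le>n. (- t) ^ m * b m n)"
        by (simp add: solution_def b_def power_minus[of "t / (real n)\<^sup>2"] power_minus[of t] power_divide power_mult)
      hence s1: "(\<lambda>m. (- t) ^ m * b m n) sums solution \<alpha> (t / (real n)\<^sup>2) n"
        by (simp only:) (rule sums_finite, auto simp: b_def solution_coeff_eq_0)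
      have s2: "(\<lambda>m. (- t) ^ m * bessel_coeff \<alpha> m) sums bessel_fun \<alpha> t"
        unfolding bessel_fun_def using summable_sums[OF summable_bessel[OF assms(1), of t]]
        by (simp add: bessel_series_coeff_def power_minus[of t] mult_ac)
      have s3: "summable (\<lambda>m. \<bar>b m n - bessel_coeff \<alpha> m\<bar> * T ^ m)"
        by (rule summable_comparison_test'[OF M]) (rule bound[OF elim(2)])
      have le: "norm ((- t) ^ m * b m n - (- t) ^ m * bessel_coeff \<alpha> m) \<le> \<bar>b m n - bessel_coeff \<alpha> m\<bar> * T ^ m" for m
      proof -
        have "norm ((- t) ^ m * b m n - (- t) ^ m * bessel_coeff \<alpha> m) = \<bar>b m n - bessel_coeff \<alpha> m\<bar> * t ^ m"
          using t by (simp add: right_diff_distrib[symmetric] abs_mult power_abs)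
        also have "\<dots> \<le> \<bar>b m n - bessel_coeff \<alpha> m\<bar> * T ^ m"
          using t by (intro mult_left_mono power_mono) auto
        finally show ?thesis .
      qed
      have "\<bar>solution \<alpha> (t / (real n)\<^sup>2) n - bessel_fun \<alpha> t\<bar> \<le> D n"
        using norm_sums_le[OF sums_diff[OF s1 s2] summable_sums[OF s3] le] by (simp add: D_def)
      thus "\<bar>solution \<alpha> (t / (real n)\<^sup>2) n - bessel_fun \<alpha> t\<bar> < e" using elim by simp
    qed
  qed
qed

section \<open>The first zero of the limit function\<close>

lemma continuous_on_bessel:
  assumes "\<alpha> > -1"
  shows "continuous_on A (bessel_fun \<alpha>)" "continuous_on A (bessel_fun' \<alpha>)"
  using bessel_fun_derivs[OF assms] by (meson DERIV_continuous_on has_field_derivative_at_within)+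

text \<open>
  By the differential equation of \<open>F\<close>, \<open>t\<^bsup>a/2\<^esup> (F' G - F G')\<close> with \<open>a = \<alpha> + 1\<close> has the derivative
  \<open>- t\<^bsup>a/2 - 1\<^esup> F (t G'' + (a/2) G' + G/4)\<close>, and it vanishes at 0 since \<open>a > 0\<close>. Subsolutions are
  covered by applying the lemma to \<open>- G\<close>.
\<close>

lemma bessel_wronskian_pos:
  fixes G G' G'' :: "real \<Rightarrow> real"
  assumes "\<alpha> > -1" "z > 0"
    and pos: "\<And>t. 0 < t \<Longrightarrow> t < z \<Longrightarrow> bessel_fun \<alpha> t > 0"
    and cont: "continuous_on {0..z} G" "continuous_on {0..z} G'"
    and G: "\<And>t. 0 < t \<Longrightarrow> t < z \<Longrightarrow> (G has_real_derivative G' t) (at t)"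
    and G': "\<And>t. 0 < t \<Longrightarrow> t < z \<Longrightarrow> (G' has_real_derivative G'' t) (at t)"
    and super: "\<And>t. 0 < t \<Longrightarrow> t < z \<Longrightarrow> t * G'' t + (\<alpha> + 1) / 2 * G' t + G t / 4 < 0"
  shows "bessel_fun' \<alpha> z * G z - bessel_fun \<alpha> z * G' z > 0"
proof -
  define b where "b = (\<alpha> + 1) / 2"
  have b: "b > 0" using assms(1) by (simp add: b_def)
  let ?F = "bessel_fun \<alpha>" and ?F1 = "bessel_fun' \<alpha>" and ?F2 = "bessel_fun'' \<alpha>"
  define W where "W = (\<lambda>t. t powr b * (?F1 t * G t - ?F t * G' t))"
  have "W 0 < W z"
  proof (rule DERIV_pos_imp_increasing_open[OF assms(2)])
    show "continuous_on {0..z} W"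
      unfolding W_def using b
      by (intro continuous_intros continuous_on_powr' cont continuous_on_bessel assms(1)) auto
    fix t assume t: "0 < t" "t < z"
    have p: "t powr b = t * t powr (b - 1)" using t(1) by (simp add: powr_diff)
    have "(W has_real_derivative b * t powr (b - 1) * (?F1 t * G t - ?F t * G' t)
        + (?F2 t * G t + ?F1 t * G' t - (?F1 t * G' t + ?F t * G'' t)) * t powr b) (at t)"
      unfolding W_def using t
      by (auto intro!: derivative_eq_intros bessel_fun_derivs assms(1) G G')
    also have "b * t powr (b - 1) * (?F1 t * G t - ?F t * G' t)
        + (?F2 t * G t + ?F1 t * G' t - (?F1 t * G' t + ?F t * G'' t)) * t powr b
      = t powr (b - 1) * ((t * ?F2 t + b * ?F1 t) * G t - ?F t * (t * G'' t + b * G' t))"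
      unfolding p by (simp add: algebra_simps)
    also have "t * ?F2 t + b * ?F1 t = - ?F t / 4"
      using bessel_ode[OF assms(1), of t] by (simp add: b_def)
    also have "- ?F t / 4 * G t - ?F t * (t * G'' t + b * G' t)
       = ?F t * - (t * G'' t + b * G' t + G t / 4)" by (simp add: algebra_simps)
    finally have "(W has_real_derivative t powr (b - 1) * (?F t * - (t * G'' t + b * G' t + G t / 4))) (at t)" .
    moreover have "t powr (b - 1) * (?F t * - (t * G'' t + b * G' t + G t / 4)) > 0"
    proof (intro mult_pos_pos)
      show "- (t * G'' t + b * G' t + G t / 4) > 0"
        using super[OF t] by (simp only: b_def neg_0_less_iff_less)
    qed (use t pos in auto)
    ultimately show "\<exists>y. (W has_real_derivative y) (at t) \<and> 0 < y" by blast
  qed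
  moreover have "W 0 = 0" using b by (simp add: W_def)
  ultimately have "z powr b * (?F1 z * G z - ?F z * G' z) > 0" by (simp add: W_def)
  thus ?thesis using assms(2) by (simp add: zero_less_mult_iff)
qed

text \<open>
  Comparison with the constant \<open>G = -1\<close>; equivalently, \<open>t\<^bsup>a/2\<^esup> F'(t)\<close> decreases from 0.
\<close>

lemma bessel_first_zero_simple:
  assumes "\<alpha> > -1" "z > 0" "\<And>t. 0 < t \<Longrightarrow> t < z \<Longrightarrow> bessel_fun \<alpha> t > 0"
  shows "bessel_fun' \<alpha> z < 0"
  using bessel_wronskian_pos[OF assms, of "\<lambda>_. -1" "\<lambda>_. 0" "\<lambda>_. 0"] by simp

text \<open>
  At a first zero \<open>z\<close> of \<open>F\<close> the positive Wronskian would be \<open>F'(z) G(z)\<close>, but \<open>F'(z) < 0\<close>.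
\<close>

lemma bessel_pos_if_supersolution:
  fixes G G' G'' :: "real \<Rightarrow> real"
  assumes "\<alpha> > -1"
    and G: "\<And>t. (G has_real_derivative G' t) (at t)"
    and G': "\<And>t. (G' has_real_derivative G'' t) (at t)"
    and super: "\<And>t. 0 < t \<Longrightarrow> t < M \<Longrightarrow> t * G'' t + (\<alpha> + 1) / 2 * G' t + G t / 4 < 0"
    and nonneg: "\<And>t. 0 < t \<Longrightarrow> t \<le> M \<Longrightarrow> G t \<ge> 0"
    and "0 \<le> t" "t \<le> M"
  shows "bessel_fun \<alpha> t > 0"
proof (rule ccontr)
  assume "\<not> bessel_fun \<alpha> t > 0"
  then obtain z where z: "0 < z" "z \<le> t" "bessel_fun \<alpha> z = 0"
    and pos: "\<And>s. 0 \<le> s \<Longrightarrow> s < z \<Longrightarrow> bessel_fun \<alpha> s > 0"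
    using first_zero[of t "bessel_fun \<alpha>"] assms(6) continuous_on_bessel[OF assms(1)] by auto
  have "bessel_fun' \<alpha> z * G z - bessel_fun \<alpha> z * G' z > 0"
  proof (rule bessel_wronskian_pos[OF assms(1) z(1)])
    show "continuous_on {0..z} G" "continuous_on {0..z} G'"
      using G G' by (meson DERIV_continuous_on has_field_derivative_at_within)+
  qed (use pos G G' super z assms(7) in auto)
  moreover have "bessel_fun' \<alpha> z < 0"
    by (rule bessel_first_zero_simple[OF assms(1) z(1)]) (use pos in auto)
  moreover have "G z \<ge> 0" using nonneg[of z] z assms(7) by simp
  ultimately show False using z(3) by (simp add: zero_less_mult_iff)
qed

text \<open>
  To the left of \<open>z\<close> the scaled solutions are eventually positive on the whole interval \<open>[0, t]\<close>, which
  bounds the Markov constant from above. Immediately to the right of \<open>z\<close>, \<open>F\<close> is negative because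
  \<open>F'(z) < 0\<close>, so the scaled solutions have acquired a zero by then, which bounds it from below.
\<close>

lemma markov_const_limit:
  assumes "\<alpha> > -1" "z > 0" "bessel_fun \<alpha> z = 0"
    and pos: "\<And>t. 0 \<le> t \<Longrightarrow> t < z \<Longrightarrow> bessel_fun \<alpha> t > 0"
  shows "(\<lambda>n. markov_const n \<alpha> / real n) \<longlonglongrightarrow> 1 / sqrt z"
proof -
  have solution_pos: "\<forall>\<^sub>F n in sequentially. \<forall>l. 0 \<le> l \<and> l \<le> t / (real n)\<^sup>2 \<longrightarrow> solution \<alpha> l n > 0"
    if t: "0 < t" "t < z" for t
  proof -
    obtain s where s: "s \<in> {0..t}" "\<And>y. y \<in> {0..t} \<Longrightarrow> bessel_fun \<alpha> s \<le> bessel_fun \<alpha> y"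
      using continuous_attains_inf[of "{0..t}" "bessel_fun \<alpha>"] continuous_on_bessel[OF assms(1)] t
      by auto
    have "bessel_fun \<alpha> s > 0" using s(1) t pos by simp
    hence "\<forall>\<^sub>F n in sequentially. \<forall>y\<in>{0..t}. \<bar>solution \<alpha> (y / (real n)\<^sup>2) n - bessel_fun \<alpha> y\<bar> < bessel_fun \<alpha> s"
      using t by (intro scaled_solution_uniform_limit assms(1)) auto
    thus ?thesis using eventually_gt_at_top[of 0]
    proof eventually_elim
      case (elim n)
      show ?case
      proof (intro allI impI)
        fix l assume l: "0 \<le> l \<and> l \<le> t / (real n)\<^sup>2"
        hence "l * (real n)\<^sup>2 \<in> {0..t}" using elim(2) by (simp add: field_simps)
        with elim(1) s(2)[OF this] show "solution \<alpha> l n > 0"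
          using elim(2) by fastforce
      qed
    qed
  qed
  have upper: "\<forall>\<^sub>F n in sequentially. markov_const n \<alpha> / real n \<le> 1 / sqrt t" if t: "0 < t" "t < z" for t
    using solution_pos[OF t] eventually_gt_at_top[of 0]
  proof eventually_elim
    case (elim n)
    have "markov_const n \<alpha> \<le> 1 / sqrt (t / (real n)\<^sup>2)"
      by (rule markov_const_le(2)[OF assms(1)]) (use elim t in auto)
    also have "\<dots> = real n / sqrt t" by (simp add: real_sqrt_divide)
    finally show ?case using elim(2) by (simp add: divide_le_eq)
  qed
  have lower: "\<forall>\<^sub>F n in sequentially. markov_const n \<alpha> / real n \<ge> 1 / sqrt u"
    if u: "u > 0" "bessel_fun \<alpha> u < 0" for u
  proof -
    have "\<forall>\<^sub>F n in sequentially. \<forall>y\<in>{0..u}. \<bar>solution \<alpha> (y / (real n)\<^sup>2) n - bessel_fun \<alpha> y\<bar> < - bessel_fun \<alpha> u"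
      using u by (intro scaled_solution_uniform_limit assms(1)) auto
    \<comment> \<open>Positivity on some interval, here for \<open>t \<le> z / 2\<close>, ensures that the supremum defining the
      Markov constant is finite.\<close>
    moreover have "\<forall>\<^sub>F n in sequentially. \<forall>l. 0 \<le> l \<and> l \<le> (z / 2) / (real n)\<^sup>2 \<longrightarrow> solution \<alpha> l n > 0"
      by (rule solution_pos) (use assms(2) in auto)
    ultimately show ?thesis using eventually_gt_at_top[of 0]
    proof eventually_elim
      case (elim n)
      have "\<bar>solution \<alpha> (u / (real n)\<^sup>2) n - bessel_fun \<alpha> u\<bar> < - bessel_fun \<alpha> u"
        using elim(1) u by simp
      hence "solution \<alpha> (u / (real n)\<^sup>2) n \<le> 0" by linarith
      hence "markov_const n \<alpha> \<ge> 1 / sqrt (u / (real n)\<^sup>2)"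
        by (intro markov_const_ge[OF assms(1), of "(z / 2) / (real n)\<^sup>2"]) (use elim u assms(2) in auto)
      also have "1 / sqrt (u / (real n)\<^sup>2) = real n / sqrt u" by (simp add: real_sqrt_divide)
      finally show ?case using elim(3) by (simp add: le_divide_eq)
    qed
  qed
  have lim: "((\<lambda>u. 1 / sqrt u) \<longlongrightarrow> 1 / sqrt z) (at z)"
    using assms(2) by (intro tendsto_intros) auto
  show ?thesis
  proof (rule order_tendstoI)
    fix y assume "y < 1 / sqrt z"
    hence "\<forall>\<^sub>F u in at_right z. y < 1 / sqrt u"
      using order_tendstoD(1)[OF lim] by (simp add: eventually_at_split)
    moreover obtain d where d: "d > 0" "\<And>h. 0 < h \<Longrightarrow> h < d \<Longrightarrow> bessel_fun \<alpha> (z + h) < bessel_fun \<alpha> z"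
      using DERIV_neg_dec_right[OF bessel_fun_derivs(1)[OF assms(1)] bessel_first_zero_simple[OF assms(1,2)]] pos
      by auto
    have "\<forall>\<^sub>F u in at_right z. bessel_fun \<alpha> u < 0"
      unfolding eventually_at_right_field
    proof (intro exI[of _ "z + d"] conjI allI impI)
      fix u assume "z < u" "u < z + d"
      thus "bessel_fun \<alpha> u < 0" using d(2)[of "u - z"] assms(3) by simp
    qed (use d in simp)
    moreover have "\<forall>\<^sub>F u in at_right z. u > z" by (simp add: eventually_at_right_less)
    ultimately have "\<forall>\<^sub>F u in at_right z. y < 1 / sqrt u \<and> bessel_fun \<alpha> u < 0 \<and> u > z"
      by eventually_elim simp
    then obtain u where u: "y < 1 / sqrt u" "bessel_fun \<alpha> u < 0" "u > z"
      using eventually_happens' trivial_limit_at_right_real by blast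
    from lower[of u] u assms(2) show "\<forall>\<^sub>F n in sequentially. y < markov_const n \<alpha> / real n"
      by (auto elim!: eventually_mono)
  next
    fix y assume "1 / sqrt z < y"
    hence "\<forall>\<^sub>F u in at_left z. 1 / sqrt u < y"
      using order_tendstoD(2)[OF lim] by (simp add: eventually_at_split)
    moreover have "\<forall>\<^sub>F u in at_left z. u \<in> {0<..<z}"
      using assms(2) by (rule eventually_at_left_real)
    ultimately have "\<forall>\<^sub>F u in at_left z. 1 / sqrt u < y \<and> 0 < u \<and> u < z"
      by eventually_elim simp
    then obtain u where u: "1 / sqrt u < y" "0 < u" "u < z"
      using eventually_happens' trivial_limit_at_left_real by blast
    from upper[of u] u show "\<forall>\<^sub>F n in sequentially. markov_const n \<alpha> / real n < y"
      by (auto elim!: eventually_mono)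
  qed
qed

section \<open>Bounds for the first zero\<close>

text \<open>
  With \<open>q = root 3 \<sigma>\<^sub>3\<close>, the comparison function \<open>G\<close> has
  \<open>- G'/G = \<sigma>\<^sub>1 + \<sigma>\<^sub>2 t + q\<^sup>3 t\<^sup>2 + q\<^sup>4 t\<^sup>3 + \<dots>\<close>, that is, \<open>G\<close> is \<open>1 - q t\<close> times an exponential of a
  quadratic polynomial. The differential equation of \<open>F\<close> is equivalent to \<open>(a/2) \<sigma>\<^sub>1 = 1/4\<close> and
  \<open>(a/2 - 1 + k) \<sigma>\<^sub>k = (\<Sum>0<i<k. \<sigma>\<^sub>i \<sigma>\<^sub>k\<^sub>-\<^sub>i)\<close> for \<open>k \<ge> 2\<close>. The coefficients of \<open>- G'/G\<close> satisfy this with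
  equality for \<open>k \<le> 3\<close>, with \<open>>\<close> for \<open>k = 4\<close> and with \<open>\<ge>\<close> for \<open>k \<ge> 5\<close>; the last two are the
  inequalities \<open>A\<close> and \<open>B\<close> of the proof. So \<open>G\<close> is a
  supersolution with zero at \<open>1 / q\<close>. In the proof \<open>p1 = \<sigma>\<^sub>1 / q\<close> and \<open>p2 = \<sigma>\<^sub>2 / q\<^sup>2\<close>.
\<close>

lemma bessel_pos_sqrt3_bound:
  fixes \<alpha> :: real
  assumes "\<alpha> > -1" "0 \<le> t" "t \<le> (\<alpha> + 1) * root 3 ((\<alpha> + 3) * (\<alpha> + 5))"
  shows "bessel_fun \<alpha> t > 0"
proof -
  define a where "a = \<alpha> + 1"
  define c where "c = root 3 ((a + 2) * (a + 4))"
  have a: "a > 0" using assms(1) by (simp add: a_def)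
  have c: "c > 0" using a by (simp add: c_def)
  have c3: "c ^ 3 = (a + 2) * (a + 4)" using a by (simp add: c_def)
  have "c ^ 3 > 2 ^ 3" unfolding c3 using a by (simp add: algebra_simps add_pos_pos)
  hence c2: "c > 2" by (rule power_less_imp_less_base) (use c in simp)
  define p1 where "p1 = c / 2"
  define p2 where "p2 = c\<^sup>2 / (2 * (a + 2))"
  define q where "q = 1 / (a * c)"
  have q: "q > 0" using a c by (simp add: q_def)
  \<comment> \<open>The relation for \<open>\<sigma>\<^sub>1\<close>, and the convolution relations for \<open>k = 2\<close> and \<open>k = 3\<close> divided by \<open>q\<^sup>k\<close>.\<close>
  have r1: "a / 2 * (p1 * q) = 1 / 4" using a c by (simp add: p1_def q_def field_simps)
  have r2: "(a / 2 + 1) * p2 = p1\<^sup>2" using a by (simp add: p1_def p2_def field_simps power2_eq_square)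
  have "2 * p1 * p2 = c ^ 3 / (2 * (a + 2))" by (simp add: p1_def p2_def power2_eq_square power3_eq_cube)
  also have "\<dots> = (a + 4) / 2" unfolding c3 using a by (simp add: field_simps)
  finally have r3: "2 * p1 * p2 = a / 2 + 2" by simp
  have B: "a / 2 + 4 - 2 * p1 - 2 * p2 \<ge> 0"
  proof -
    have "c \<le> (a + 4) / 2"
    proof (rule power_le_imp_le_base)
      have "8 * (a + 2) \<le> (a + 4)\<^sup>2" by (simp add: power2_eq_square algebra_simps)
      from mult_right_mono[OF this, of "a + 4"] a
      have "8 * c ^ 3 \<le> (a + 4) ^ 3"
        unfolding c3 by (simp add: power2_eq_square power3_eq_cube algebra_simps)
      thus "c ^ Suc 2 \<le> ((a + 4) / 2) ^ Suc 2"
        by (simp add: power_divide)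
    qed (use a in simp)
    \<comment> \<open>After multiplication by \<open>c\<close> and with \<open>c\<^sup>3 = (a + 2) (a + 4)\<close>, \<open>B\<close> becomes a quadratic
      inequality in \<open>c\<close> with roots \<open>2\<close> and \<open>(a + 4) / 2\<close>.\<close>
    hence "(c - 2) * ((a + 4) / 2 - c) \<ge> 0" using c2 by simp
    hence "c * (a / 2 + 4 - c) \<ge> a + 4" by (simp add: field_simps)
    moreover have "c * (2 * p2) = a + 4"
    proof -
      have "c * (2 * p2) = c ^ 3 / (a + 2)"
        using a by (simp add: p2_def power2_eq_square power3_eq_cube field_simps)
      thus ?thesis unfolding c3 using a by simp
    qed
    ultimately have "c * (2 * p2) \<le> c * (a / 2 + 4 - c)" by simp
    hence "2 * p2 \<le> a / 2 + 4 - c" using c by (simp only: mult_le_cancel_left_pos)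
    thus ?thesis by (simp add: p1_def)
  qed
  have A: "a / 2 + 3 - 2 * p1 - p2\<^sup>2 > 0"
  proof -
    \<comment> \<open>This is \<open>A\<close> cleared of denominators; cubing removes the root \<open>c\<close>.\<close>
    have "c * (5 * a + 12) < 2 * (a + 6) * (a + 2)"
    proof (rule power_less_imp_less_base)
      have "(2 * (a + 6) * (a + 2)) ^ 3 - (c * (5 * a + 12)) ^ 3
        = (a + 2) * (8 * (a + 6) ^ 3 * (a + 2)\<^sup>2 - (a + 4) * (5 * a + 12) ^ 3)"
        unfolding power_mult_distrib c3 by (simp add: algebra_simps power2_eq_square power3_eq_cube)
      also have "8 * (a + 6) ^ 3 * (a + 2)\<^sup>2 - (a + 4) * (5 * a + 12) ^ 3
         = 8 * a ^ 5 + 51 * a ^ 4 + 72 * a ^ 3"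
        by (simp add: algebra_simps eval_nat_numeral)
      also have "(a + 2) * \<dots> > 0" using a by (intro mult_pos_pos add_pos_pos) auto
      finally show "(c * (5 * a + 12)) ^ 3 < (2 * (a + 6) * (a + 2)) ^ 3" by simp
    qed (use a in simp)
    moreover have "p2\<^sup>2 = c * (a + 4) / (4 * (a + 2))"
    proof -
      have "p2\<^sup>2 = c * c ^ 3 / (4 * (a + 2)\<^sup>2)"
        using a by (simp add: p2_def power2_eq_square power3_eq_cube field_simps)
      thus ?thesis unfolding c3 using a by (simp add: power2_eq_square)
    qed
    moreover have "c + c * (a + 4) / (4 * (a + 2)) = c * (5 * a + 12) / (4 * (a + 2))"
      using a by (simp add: field_simps)
    moreover have "a / 2 + 3 = 2 * (a + 6) * (a + 2) / (4 * (a + 2))"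
      using a by (simp add: field_simps)
    ultimately have "c + p2\<^sup>2 < a / 2 + 3" using a by (simp add: divide_strict_right_mono)
    thus ?thesis by (simp add: p1_def)
  qed
  define P where "P = (\<lambda>t. q * (p1 - 1) + q\<^sup>2 * (p2 - 1) * t)"
  define E where "E = (\<lambda>t. exp (- (q * (p1 - 1) * t + q\<^sup>2 * (p2 - 1) * t\<^sup>2 / 2)))"
  have E: "(E has_real_derivative - P t * E t) (at t)" for t
  proof -
    have "((\<lambda>t. - (q * (p1 - 1) * t + q\<^sup>2 * (p2 - 1) * t\<^sup>2 / 2)) has_real_derivative - P t) (at t)"
      unfolding P_def by (auto intro!: derivative_eq_intros simp: field_simps)
    from DERIV_chain2[OF DERIV_exp this] show ?thesis
      unfolding E_def by (simp add: mult.commute)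
  qed
  have P: "(P has_real_derivative q\<^sup>2 * (p2 - 1)) (at t)" for t
    unfolding P_def by (auto intro!: derivative_eq_intros)
  show ?thesis
  proof (rule bessel_pos_if_supersolution[OF assms(1)])
    show "((\<lambda>t. (1 - q * t) * E t) has_real_derivative - (q + (1 - q * t) * P t) * E t) (at t)" for t
      by (auto intro!: derivative_eq_intros E simp: algebra_simps)
    show "((\<lambda>t. - (q + (1 - q * t) * P t) * E t) has_real_derivative
        (2 * q * P t + (1 - q * t) * (P t)\<^sup>2 - (1 - q * t) * (q\<^sup>2 * (p2 - 1))) * E t) (at t)" for t
      by (auto intro!: derivative_eq_intros E P simp: algebra_simps power2_eq_square)
    show "(1 - q * s) * E s \<ge> 0" if "0 < s" "s \<le> a * c" for s
    proof -
      have "q * s \<le> 1" using that a c by (simp add: q_def)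
      thus ?thesis by (simp add: E_def)
    qed
    show "0 \<le> t" by fact
    show "t \<le> a * c" using assms(3) by (simp add: a_def c_def add.commute)
    fix s assume s: "0 < s" "s < a * c"
    define x where "x = q * s"
    have x: "0 < x" "x < 1" using s a c q by (auto simp: x_def q_def)
    define Q where "Q = (p1 - 1) + (p2 - 1) * x"
    have Ps: "P s = q * Q" by (simp add: P_def Q_def x_def algebra_simps power2_eq_square)
    have "s * (2 * q * P s + (1 - q * s) * (P s)\<^sup>2 - (1 - q * s) * (q\<^sup>2 * (p2 - 1)))
        + (\<alpha> + 1) / 2 * - (q + (1 - q * s) * P s) + (1 - q * s) / 4
      = q * (x * (2 * Q + (1 - x) * Q\<^sup>2 - (1 - x) * (p2 - 1)) - a / 2 * (1 + (1 - x) * Q)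
          + (1 - x) * (a / 2 * p1))"
    proof -
      have "(1 - x) / 4 = (1 - x) * (a / 2 * (p1 * q))" unfolding r1 by simp
      thus ?thesis
        unfolding Ps a_def[symmetric] x_def[symmetric]
        by (simp only:) (simp add: x_def power2_eq_square field_simps)
    qed
    \<comment> \<open>The coefficients on the right are the defects in the convolution relations for \<open>k = 2, 3, 4\<close>
      and \<open>k \<ge> 5\<close>; the first two vanish.\<close>
    also have "x * (2 * Q + (1 - x) * Q\<^sup>2 - (1 - x) * (p2 - 1)) - a / 2 * (1 + (1 - x) * Q)
          + (1 - x) * (a / 2 * p1)
        = - (((a / 2 + 1) * p2 - p1\<^sup>2) * x * (1 - x) + (a / 2 + 2 - 2 * p1 * p2) * x\<^sup>2 * (1 - x)
          + (a / 2 + 3 - 2 * p1 - p2\<^sup>2) * x ^ 3 * (1 - x) + (a / 2 + 4 - 2 * p1 - 2 * p2) * x ^ 4)"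
      unfolding Q_def by (simp add: field_simps eval_nat_numeral)
    also have "\<dots> = - ((a / 2 + 3 - 2 * p1 - p2\<^sup>2) * x ^ 3 * (1 - x) + (a / 2 + 4 - 2 * p1 - 2 * p2) * x ^ 4)"
      unfolding r2 r3 by simp
    also have "q * \<dots> < 0"
    proof -
      have "(a / 2 + 3 - 2 * p1 - p2\<^sup>2) * x ^ 3 * (1 - x) > 0" using A x by simp
      moreover have "(a / 2 + 4 - 2 * p1 - 2 * p2) * x ^ 4 \<ge> 0" using B x by simp
      ultimately have "q * ((a / 2 + 3 - 2 * p1 - p2\<^sup>2) * x ^ 3 * (1 - x) + (a / 2 + 4 - 2 * p1 - 2 * p2) * x ^ 4) > 0"
        by (rule mult_pos_pos[OF q add_pos_nonneg])
      thus ?thesis by (simp only: mult_minus_right neg_less_0_iff_less)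
    qed
    finally have neg: "s * (2 * q * P s + (1 - q * s) * (P s)\<^sup>2 - (1 - q * s) * (q\<^sup>2 * (p2 - 1)))
        + (\<alpha> + 1) / 2 * - (q + (1 - q * s) * P s) + (1 - q * s) / 4 < 0" .
    have "E s > 0" by (simp add: E_def)
    from mult_neg_pos[OF neg this]
    show "s * ((2 * q * P s + (1 - q * s) * (P s)\<^sup>2 - (1 - q * s) * (q\<^sup>2 * (p2 - 1))) * E s)
        + (\<alpha> + 1) / 2 * (- (q + (1 - q * s) * P s) * E s) + (1 - q * s) * E s / 4 < 0"
      by (simp only: distrib_right mult.assoc times_divide_eq_left)
  qed
qed

text \<open>
  With \<open>b = (\<alpha> + 1) / 2\<close> and \<open>M = b\<^sup>2 + 4 b\<close>, the function \<open>G(t) = (1 - t/M) exp (- b t / (2 M))\<close> is a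
  supersolution with zero at \<open>M\<close>. Among the functions \<open>(1 - t/M) exp (- k t)\<close>, being a supersolution
  near \<open>M\<close> requires \<open>k M \<le> b / 2\<close>, and in the extreme case \<open>k M = b / 2\<close> it amounts to
  \<open>M \<le> b\<^sup>2 + 4 b\<close>.
\<close>

lemma bessel_pos_quadratic_bound:
  fixes \<alpha> :: real
  assumes "\<alpha> > -1" "0 \<le> t" "t \<le> (\<alpha> + 1) * (\<alpha> + 9) / 4"
  shows "bessel_fun \<alpha> t > 0"
proof -
  define b where "b = (\<alpha> + 1) / 2"
  define q where "q = 1 / (b\<^sup>2 + 4 * b)"
  define k where "k = b / 2 * q"
  have b: "b > 0" using assms(1) by (simp add: b_def)
  have M: "b\<^sup>2 + 4 * b > 0" using b by (simp add: add_pos_pos)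
  have q: "q > 0" using M by (simp add: q_def)
  have qM: "q * (b\<^sup>2 + 4 * b) = 1" using M by (simp add: q_def)
  define E where "E = (\<lambda>t. exp (- k * t))"
  have E: "(E has_real_derivative - k * E t) (at t)" for t
    unfolding E_def by (auto intro!: derivative_eq_intros)
  show ?thesis
  proof (rule bessel_pos_if_supersolution[OF assms(1)])
    show "((\<lambda>t. (1 - q * t) * E t) has_real_derivative - (q + (1 - q * t) * k) * E t) (at t)" for t
      by (auto intro!: derivative_eq_intros E simp: algebra_simps)
    show "((\<lambda>t. - (q + (1 - q * t) * k) * E t) has_real_derivative
        (2 * q * k + (1 - q * t) * k\<^sup>2) * E t) (at t)" for t
      by (auto intro!: derivative_eq_intros E simp: algebra_simps power2_eq_square)
    show "(1 - q * s) * E s \<ge> 0" if "0 < s" "s \<le> b\<^sup>2 + 4 * b" for s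
    proof -
      have "q * s \<le> 1" using that M by (simp add: q_def)
      thus ?thesis by (simp add: E_def)
    qed
    show "0 \<le> t" by fact
    show "t \<le> b\<^sup>2 + 4 * b" using assms(3) by (simp add: b_def power2_eq_square field_simps)
    fix s assume s: "0 < s" "s < b\<^sup>2 + 4 * b"
    define x where "x = q * s"
    have x: "0 < x" "x < 1" using s M q by (auto simp: x_def q_def)
    have "(s * (2 * q * k + (1 - q * s) * k\<^sup>2) + b * - (q + (1 - q * s) * k)) + (1 - q * s) / 4
        = q * (x * (b + (1 - x) * b\<^sup>2 / 4) - b * (1 + (1 - x) * (b / 2)))
          + q * (b\<^sup>2 + 4 * b) * (1 - x) / 4"
      unfolding qM k_def x_def by (simp add: field_simps power2_eq_square)
    also have "\<dots> = - (q * (1 - x)\<^sup>2 * b\<^sup>2 / 4)"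
      by (simp add: field_simps power2_eq_square)
    also have "\<dots> < 0" using q x b by simp
    finally have neg: "(s * (2 * q * k + (1 - q * s) * k\<^sup>2) + b * - (q + (1 - q * s) * k)) + (1 - q * s) / 4 < 0" .
    have "E s > 0" by (simp add: E_def)
    from mult_neg_pos[OF neg this]
    show "s * ((2 * q * k + (1 - q * s) * k\<^sup>2) * E s)
        + (\<alpha> + 1) / 2 * (- (q + (1 - q * s) * k) * E s) + (1 - q * s) * E s / 4 < 0"
      unfolding b_def[symmetric] by (simp only: distrib_right mult.assoc times_divide_eq_left)
  qed
qed

text \<open>
  Now \<open>q = \<sigma>\<^sub>3 / \<sigma>\<^sub>2\<close> and \<open>- G'/G = \<sigma>\<^sub>1 + \<sigma>\<^sub>2 t / (1 - q t)\<close>, so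
  \<open>G(t) = (1 - q t)\<^sup>A exp (- c t)\<close> with \<open>A = \<sigma>\<^sub>2 / q\<^sup>2\<close> and \<open>c = \<sigma>\<^sub>1 - \<sigma>\<^sub>2 / q\<close>. It satisfies the convolution
  relation with equality for \<open>k \<le> 3\<close> and with the reversed strict inequality from \<open>k = 4\<close> on, because
  \<open>q\<^sup>2 < \<sigma>\<^sub>2\<close>; so it is a subsolution. The same inequality says \<open>A > 1\<close>, hence \<open>G\<close> and \<open>G'\<close> both vanish
  at \<open>M = 1 / q\<close>, and the Wronskian is zero there, which is impossible if \<open>F\<close> is positive up to \<open>M\<close>.
\<close>

lemma bessel_zero_upper_bound:
  fixes \<alpha> :: real
  assumes "\<alpha> > -1"
  obtains t where "0 \<le> t" "t < (\<alpha> + 1) * (\<alpha> + 5) / 2" "bessel_fun \<alpha> t \<le> 0"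
proof -
  define a where "a = \<alpha> + 1"
  define M where "M = a * (a + 4) / 2"
  define q where "q = 1 / M"
  define c where "c = 1 / (4 * (a + 2))"
  define A where "A = (a + 4)\<^sup>2 / (8 * (a + 2))"
  have a: "a > 0" using assms by (simp add: a_def)
  have M: "M > 0" using a by (simp add: M_def)
  have q: "q > 0" using M by (simp add: q_def)
  have A: "A > 1" using a by (simp add: A_def power2_eq_square field_simps)
  define d where "d = (\<lambda>t. 1 - q * t)"
  have d: "d t > 0" if "t < M" for t using that M by (simp add: d_def q_def)
  have d0: "d t \<ge> 0" if "t \<le> M" for t using that M by (simp add: d_def q_def)
  define D where "D = (\<lambda>r t. d t powr r)"
  define G where "G = (\<lambda>t. exp (- c * t) * D A t)"
  define G' where "G' = (\<lambda>t. - exp (- c * t) * (c * D A t + A * q * D (A - 1) t))"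
  define G'' where "G'' = (\<lambda>t. exp (- c * t) *
    (c\<^sup>2 * D A t + 2 * c * A * q * D (A - 1) t + A * (A - 1) * q\<^sup>2 * D (A - 2) t))"
  have dp: "(D r has_real_derivative - q * (r * D (r - 1) t)) (at t)" if "t < M" for t r
    using d[OF that] unfolding D_def d_def by (auto intro!: derivative_eq_intros)
  have "\<exists>t. 0 \<le> t \<and> t < M \<and> bessel_fun \<alpha> t \<le> 0"
  proof (rule ccontr)
    assume "\<nexists>t. 0 \<le> t \<and> t < M \<and> bessel_fun \<alpha> t \<le> 0"
    hence pos: "bessel_fun \<alpha> t > 0" if "0 < t" "t < M" for t using that by (meson less_imp_le not_le)
    have "bessel_fun' \<alpha> M * (- G M) - bessel_fun \<alpha> M * (- G' M) > 0"
    proof (rule bessel_wronskian_pos[OF assms M pos])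
      have cd: "continuous_on {0..M} (\<lambda>t. D r t)" if "r > 0" for r
        unfolding D_def using that d0 by (intro continuous_on_powr') (auto simp: d_def intro!: continuous_intros)
      show "continuous_on {0..M} (\<lambda>t. - G t)" "continuous_on {0..M} (\<lambda>t. - G' t)"
        unfolding G_def G'_def using A by (intro continuous_intros cd; simp)+
      fix t assume t: "0 < t" "t < M"
      have A2: "A - 1 - 1 = A - 2" by simp
      show "((\<lambda>t. - G t) has_real_derivative - G' t) (at t)"
        unfolding G_def G'_def
        by (auto intro!: derivative_eq_intros dp t simp: algebra_simps)
      show "((\<lambda>t. - G' t) has_real_derivative - G'' t) (at t)"
        unfolding G'_def G''_def
        by (auto intro!: derivative_eq_intros dp t simp: A2 algebra_simps power2_eq_square)
      have p1: "D (A - 1) t = d t * D (A - 2) t"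
        using powr_mult_base[of "d t" "A - 2"] d[OF t(2)] by (simp add: D_def)
      have p0: "D A t = (d t)\<^sup>2 * D (A - 2) t"
        using powr_mult_base[of "d t" "A - 1"] d[OF t(2)] p1 by (simp add: D_def power2_eq_square)
      have "t * G'' t + a / 2 * G' t + G t / 4 = exp (- c * t) * D (A - 2) t *
         (t * (c\<^sup>2 * (d t)\<^sup>2 + 2 * c * A * q * d t + A * (A - 1) * q\<^sup>2)
          - a / 2 * (c * (d t)\<^sup>2 + A * q * d t) + (d t)\<^sup>2 / 4)"
        unfolding G_def G'_def G''_def p0 p1 by (simp add: algebra_simps)
      also have "t * (c\<^sup>2 * (d t)\<^sup>2 + 2 * c * A * q * d t + A * (A - 1) * q\<^sup>2)
          - a / 2 * (c * (d t)\<^sup>2 + A * q * d t) + (d t)\<^sup>2 / 4 = t ^ 3 * (c * q)\<^sup>2"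
      proof -
        have "c = 1 / (4 * (a + 2))" "q = 2 / (a * (a + 4))" by (simp_all add: c_def q_def M_def)
        hence "4 * (a + 2) * c = 1" "a * (a + 4) * q = 2" using a by simp_all
        moreover have "2 * A = (a + 4)\<^sup>2 * c" using a by (simp add: A_def c_def field_simps)
        \<comment> \<open>The terms in \<open>1\<close>, \<open>t\<close> and \<open>t\<^sup>2\<close> cancel by the relations for \<open>k \<le> 3\<close>; what is left is the
          defect \<open>\<sigma>\<^sub>2 (\<sigma>\<^sub>2 - q\<^sup>2) t\<^sup>3\<close>, which equals \<open>t\<^sup>3 (c q)\<^sup>2\<close>.\<close>
        ultimately show ?thesis unfolding d_def by algebra
      qed
      also have "exp (- c * t) * D (A - 2) t * (t ^ 3 * (c * q)\<^sup>2) > 0"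
        using t d[of t] q a by (auto simp: c_def D_def)
      finally show "t * - G'' t + (\<alpha> + 1) / 2 * - G' t + - G t / 4 < 0"
        by (simp add: a_def field_simps)
    qed
    moreover have "d M = 0" using M by (simp add: d_def q_def)
    hence "G M = 0" "G' M = 0" using A by (simp_all add: G_def G'_def D_def)
    ultimately show False by simp
  qed
  then obtain t where "0 \<le> t" "t < M" "bessel_fun \<alpha> t \<le> 0" by blast
  thus ?thesis using that[of t] by (simp add: M_def a_def add.commute)
qed

section \<open>The threshold and the asymptotic Markov constant\<close>

text \<open>
  In the variable \<open>y = 1 / (a + 1)\<close> the threshold equation is polynomial, and the polynomial
  crosses 1 between \<open>1 / 44.44\<close> and \<open>1 / 44.36\<close>.
\<close>

lemma alpha_star_approx: "\<bar>alpha_star - 43.4\<bar> < 0.05"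
proof -
  define h :: "real \<Rightarrow> real" where
    "h = (\<lambda>y. 40*y + 195*y^2 + 48*y^3 + 189*y^4 - 24*y^5 + y^6)"
  have "\<exists>y. 1 / 44.44 \<le> y \<and> y \<le> 1 / 44.36 \<and> h y = 1"
    by (rule IVT') (auto simp: h_def power_divide intro!: continuous_intros)
  then obtain y where y: "1 / 44.44 \<le> y" "y \<le> 1 / 44.36" "h y = 1" by blast
  define a where "a = 1 / y - 1"
  have y0: "y > 0" using y(1) by simp
  have ya: "1 / (a + 1) = y" by (simp add: a_def)
  have "1 / y \<le> 44.44" "44.36 \<le> 1 / y" using y y0 by (auto simp: field_simps)
  hence a: "43.36 \<le> a" "a \<le> 43.44" by (simp_all add: a_def)
  have "a > -1 \<and> 1 / ((a + 1) * root 3 ((a + 3) * (a + 5))) = 4 / (a\<^sup>2 + 10 * a + 8)"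
    using bounds_agree_iff[of a] y(3) a unfolding ya by (simp add: h_def)
  hence "alpha_star = a"
    unfolding alpha_star_def using alpha_star_ex1 by (rule the1_equality[rotated])
  thus ?thesis using a by (simp add: abs_if)
qed

theorem corollary1p4:
  shows "\<bar>alpha_star - 43.4\<bar> < 0.05 \<and>
    (\<forall>\<alpha>::real. \<alpha> > -1 \<longrightarrow>
       convergent (\<lambda>n. markov_const n \<alpha> / real n) \<and>
       2 / ((\<alpha> + 1) * (\<alpha> + 5)) < (asymp_markov_const \<alpha>)\<^sup>2 \<and>
       (asymp_markov_const \<alpha>)\<^sup>2 <
         (if \<alpha> \<le> alpha_star then 1 / ((\<alpha> + 1) * root 3 ((\<alpha> + 3) * (\<alpha> + 5)))
          else 4 / (\<alpha>\<^sup>2 + 10 * \<alpha> + 8)))"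
proof (intro conjI allI impI)
  show "\<bar>alpha_star - 43.4\<bar> < 0.05" by (rule alpha_star_approx)
  fix \<alpha> :: real assume \<alpha>: "\<alpha> > -1"
  obtain t where t: "0 \<le> t" "t < (\<alpha> + 1) * (\<alpha> + 5) / 2" "bessel_fun \<alpha> t \<le> 0"
    using bessel_zero_upper_bound[OF \<alpha>] by blast
  obtain z where z: "0 < z" "z \<le> t" "bessel_fun \<alpha> z = 0"
    and pos: "\<And>s. 0 \<le> s \<Longrightarrow> s < z \<Longrightarrow> bessel_fun \<alpha> s > 0"
    using first_zero[of t "bessel_fun \<alpha>"] t continuous_on_bessel[OF \<alpha>] by auto
  have lim: "(\<lambda>n. markov_const n \<alpha> / real n) \<longlonglongrightarrow> 1 / sqrt z"
    by (rule markov_const_limit[OF \<alpha> z(1,3) pos])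
  thus "convergent (\<lambda>n. markov_const n \<alpha> / real n)" by (rule convergentI)
  have c2: "(asymp_markov_const \<alpha>)\<^sup>2 = 1 / z"
    using limI[OF lim] z(1) by (simp add: asymp_markov_const_def power_divide)
  have "1 / ((\<alpha> + 1) * (\<alpha> + 5) / 2) < 1 / z"
    using z t by (intro divide_strict_left_mono) auto
  thus "2 / ((\<alpha> + 1) * (\<alpha> + 5)) < (asymp_markov_const \<alpha>)\<^sup>2" by (simp add: c2)
  have z1: "z > (\<alpha> + 1) * root 3 ((\<alpha> + 3) * (\<alpha> + 5))"
    using bessel_pos_sqrt3_bound[OF \<alpha>, of z] z by (force simp: not_less)
  have z2: "z > (\<alpha> + 1) * (\<alpha> + 9) / 4"
    using bessel_pos_quadratic_bound[OF \<alpha>, of z] z by (force simp: not_less)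
  show "(asymp_markov_const \<alpha>)\<^sup>2 <
         (if \<alpha> \<le> alpha_star then 1 / ((\<alpha> + 1) * root 3 ((\<alpha> + 3) * (\<alpha> + 5)))
          else 4 / (\<alpha>\<^sup>2 + 10 * \<alpha> + 8))"
  proof (cases "\<alpha> \<le> alpha_star")
    case True
    have "1 / z < 1 / ((\<alpha> + 1) * root 3 ((\<alpha> + 3) * (\<alpha> + 5)))"
      using z1 z(1) \<alpha> by (intro divide_strict_left_mono) auto
    thus ?thesis using True by (simp add: c2)
  next
    case False
    hence "\<alpha> > 0" using alpha_star_approx by (simp add: abs_if split: if_splits)
    hence "\<alpha>\<^sup>2 + 10 * \<alpha> + 8 > 0" by (simp add: add_pos_pos)
    moreover have "\<alpha>\<^sup>2 + 10 * \<alpha> + 8 < 4 * z"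
      using z2 by (simp add: power2_eq_square algebra_simps)
    ultimately have "1 / z < 4 / (\<alpha>\<^sup>2 + 10 * \<alpha> + 8)"
      using z(1) by (simp add: field_simps)
    thus ?thesis using False by (simp add: c2)
  qed
qed

end
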